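(* Consider the distributed convex optimization problem and the differentially private linearized ADMM with multiple local updates described in the context, and let $\bar\epsilon>0$ be the privacy budget parameter. Suppose that: (i) $0<\rho^1\le\rho^2\le\dots\le\rho^T\le\rho^{\max}$, and $\rho^t\le\frac{t}{t-1}\rho^{t-1}$ for all $t\ge2$; (ii) $\gamma>0$ satisfies $\gamma\ge2\|\lambda^*\|$, where $\lambda^*$ is a dual optimal solution, and $\|\lambda^t\|\le\gamma$ for all $t$; (iii) each $f_p$ is $H$-Lipschitz over $\mathcal{W}_p$ with respect to the Euclidean norm. Suppose further that each $f_p$ is $\alpha$-strongly convex ($\alpha>0$) and that $\eta^t=\dfrac{2}{\alpha(t+2)}$ for all $t$. Then $$\mathbb{E}\Big[F(z^{(T)})-F(z^* )+\gamma\|Aw^{(T)}-z^{(T)}\|\Big]\le\frac{1}{T+1}\Big\{2U_2\gamma+U_2^2\rho^{\max}+\frac{4\gamma^2}{\rho^1}+\frac{\alpha U_2^2}{2E}+\frac{2P(U_1^2+nU_3/\bar\epsilon^2)}{\alpha}\Big\},$$ where $z^{(T)}:=\frac{2}{T(T+1)}\sum_{t=1}^Tt\Big(\frac1E\sum_{e=1}^Ez^{t,e}\Big)$, $w^{(T)}:=\frac{2}{T(T+1)}\sum_{t=1}^Tt\,w^{t+1}$, and $z^*$ is (the $z$-part of) an optimal solution of the consensus problem in the context.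
   Context: Problem: $\min_{w\in\mathbb{R}^n,\,z_p\in\mathcal{W}_p}\sum_{p=1}^P f_p(z_p)$ subject to $w=z_p$ for all $p=1,\dots,P$ (the consensus problem), where each $\mathcal{W}_p\subset\mathbb{R}^n$ is compact and convex, $\bigcap_p\mathcal{W}_p\ne\emptyset$, and each $f_p$ is convex. $\lambda=(\lambda_1,\dots,\lambda_P)$ are the multipliers of the consensus constraints $w=z_p$. $f'_p(z)$ denotes a subgradient of $f_p$ at $z$; $f_p$ depends on a dataset $\mathcal{D}_p$ and we write $f'_p(z;\mathcal{D}_p)$ when this matters. Datasets are neighboring if they differ in a single entry. Algorithm: given $\lambda^1_p,z^1_p\in\mathbb{R}^n$, set $z^{0,E+1}_p=z^1_p$. For $t=1,\dots,T$: (1) $w^{t+1}=\frac1P\sum_{p=1}^P(z^t_p-\frac1{\rho^t}\lambda^t_p)$; (2) for each $p$, $z^{t,1}_p=z^{t-1,E+1}_p$, and for $e=1,\dots,E$, $$z^{t,e+1}_p=\arg\min_{z_p\in\mathcal{W}_p}\ \langle f'_p(z^{t,e}_p),z_p\rangle+\frac{1}{2\eta^t}\|z_p-z^{t,e}_p\|^2+\frac{\rho^t}{2}\Big\|w^{t+1}-z_p+\frac1{\rho^t}(\lambda^t_p-\tilde\xi^{t,e}_p)\Big\|^2;$$ (3) for each $p$, $z^{t+1}_p=\frac1E\sum_{e=1}^Ez^{t,e+1}_p$ and $\lambda^{t+1}_p=\lambda^t_p+\rho^t(w^{t+1}-z^{t+1}_p)$. Noise: the vectors $\tilde\xi^{t,e}_p\in\mathbb{R}^n$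 are freshly drawn and, given the current iterate $z^{t,e}_p$, have i.i.d. zero-mean entries that are either all Laplace with variance $2(\bar\Delta^{t,e}_{p,1}/\bar\epsilon)^2$ (Laplace mechanism) or all Gaussian with variance $2\ln(1.25/\bar\delta)(\bar\Delta^{t,e}_{p,2}/\bar\epsilon)^2$, $\bar\delta\in(0,1)$ (Gaussian mechanism), where $\bar\Delta^{t,e}_{p,q}:=\max\|f'_p(z^{t,e}_p;\mathcal{D}_p)-f'_p(z^{t,e}_p;\mathcal{D}'_p)\|_q$ over all pairs of neighboring datasets. Notation: $\|\cdot\|$ is the Euclidean norm; $z=[z_1^\top,\dots,z_P^\top]^\top$, $\lambda=[\lambda_1^\top,\dots,\lambda_P^\top]^\top$ (likewise for superscripted versions such as $z^{t,e}$, $\lambda^t$); $F(z)=\sum_{p=1}^Pf_p(z_p)$; $A^\top=[\mathbb{I}_n\ \cdots\ \mathbb{I}_n]$ ($P$ blocks, size $n\times Pn$). $U_1:=\max_{p\in[P]}\max_{u\in\mathcal{W}_p}\|f'_p(u)\|$. $U_2:=\max_{p\in[P]}\max_{u,v\in\mathcal{W}_p}\|u-v\|$. $U_3$ is the maximum, over $p\in[P]$ (and over all $t\in[T]$, $e\in[E]$ and all realizations of the iterates), of $2(\bar\Delta^{t,e}_{p,1})^2$ for the Laplace mechanism, and of $2\ln(1.25/\bar\delta)(\bar\Delta^{t,e}_{p,2})^2$ for the Gaussian mechanism.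
   Formalization: U_2 is taken as the largest distance between stacked points of W_1×…×W_P, not the largest diameter of a single W_p, and the initial points z^1_p are required to lie in W_p; the bound fails without either change. *)

theory Defs
  imports "HOL-Probability.Probability"
begin

text \<open>
  Agents are the elements of a finite type \<open>'p\<close>, so \<open>P = CARD('p)\<close>; a stacked vector
  \<open>[z_1; ...; z_P]\<close> is an element of \<open>(real^'n)^'p\<close>, whose norm is the Euclidean norm of the
  stacked vector.
\<close>

section \<open>Convexity notions\<close>

text \<open>Subgradients of a function whose effective domain is \<open>S\<close>; a subgradient of a convex function
  defined on a larger set is one in this sense.\<close>

definition is_subgradient ::
  "'a::real_inner set \<Rightarrow> ('a \<Rightarrow> real) \<Rightarrow> 'a \<Rightarrow> 'a \<Rightarrow> bool" where
  "is_subgradient S f x g \<longleftrightarrow> x \<in> S \<and> (\<forall>y\<in>S. f y \<ge> f x + g \<bullet> (y - x))"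

definition strongly_convex_on ::
  "real \<Rightarrow> 'a::real_inner set \<Rightarrow> ('a \<Rightarrow> real) \<Rightarrow> bool" where
  "strongly_convex_on \<alpha> S f \<longleftrightarrow> convex S \<and>
     (\<forall>x\<in>S. \<forall>y\<in>S. \<forall>u\<ge>0. \<forall>v\<ge>0. u + v = 1 \<longrightarrow>
        f (u *\<^sub>R x + v *\<^sub>R y) \<le> u * f x + v * f y - \<alpha> / 2 * (u * v) * (norm (x - y))\<^sup>2)"

section \<open>The consensus problem and its dual\<close>

definition feasible_blocks :: "('p \<Rightarrow> (real^'n) set) \<Rightarrow> ((real^'n)^'p::finite) set" where
  "feasible_blocks W = {z. \<forall>p. z $ p \<in> W p}"

definition total_cost :: "('p \<Rightarrow> real^'n \<Rightarrow> real) \<Rightarrow> (real^'n)^'p::finite \<Rightarrow> real" where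
  "total_cost f z = (\<Sum>p\<in>UNIV. f p (z $ p))"

definition stack :: "real^'n \<Rightarrow> (real^'n)^'p::finite" where
  "stack w = (\<chi> p. w)"

definition consensus_optimal ::
  "('p \<Rightarrow> (real^'n) set) \<Rightarrow> ('p \<Rightarrow> real^'n \<Rightarrow> real) \<Rightarrow> real^'n \<Rightarrow> (real^'n)^'p::finite \<Rightarrow> bool" where
  "consensus_optimal W f w z \<longleftrightarrow>
     is_arg_min (\<lambda>(w, z). total_cost f z)
       (\<lambda>(w, z). z \<in> feasible_blocks W \<and> stack w = z) (w, z)"

definition lagrangian ::
  "('p \<Rightarrow> real^'n \<Rightarrow> real) \<Rightarrow> real^'n \<Rightarrow> (real^'n)^'p::finite \<Rightarrow> (real^'n)^'p \<Rightarrow> real" where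
  "lagrangian f w z \<mu> = total_cost f z + \<mu> \<bullet> (stack w - z)"

text \<open>The dual function is \<open>-\<infinity>\<close> unless the blocks of the multiplier sum to zero.\<close>

definition dual_function ::
  "('p \<Rightarrow> (real^'n) set) \<Rightarrow> ('p \<Rightarrow> real^'n \<Rightarrow> real) \<Rightarrow> (real^'n)^'p::finite \<Rightarrow> ereal" where
  "dual_function W f \<mu> =
     (INF (w, z)\<in>UNIV \<times> feasible_blocks W. ereal (lagrangian f w z \<mu>))"

definition dual_optimal ::
  "('p \<Rightarrow> (real^'n) set) \<Rightarrow> ('p \<Rightarrow> real^'n \<Rightarrow> real) \<Rightarrow> (real^'n)^'p::finite \<Rightarrow> bool" where
  "dual_optimal W f \<mu> \<longleftrightarrow> (\<forall>\<nu>. dual_function W f \<nu> \<le> dual_function W f \<mu>)"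

section \<open>Privacy mechanisms\<close>

definition neighboring :: "'d list \<Rightarrow> 'd list \<Rightarrow> bool" where
  "neighboring D D' \<longleftrightarrow> length D = length D' \<and> card {i. i < length D \<and> D ! i \<noteq> D' ! i} = 1"

datatype mechanism = Laplace | Gaussian (failure_prob: real)

definition valid_mechanism :: "mechanism \<Rightarrow> bool" where
  "valid_mechanism m = (case m of Laplace \<Rightarrow> True | Gaussian \<delta> \<Rightarrow> 0 < \<delta> \<and> \<delta> < 1)"

text \<open>The 1-norm calibrates the Laplace mechanism, the 2-norm the Gaussian one.\<close>

definition mechanism_norm :: "mechanism \<Rightarrow> real^'n \<Rightarrow> real" where
  "mechanism_norm m x = (case m of Laplace \<Rightarrow> (\<Sum>i\<in>UNIV. \<bar>x $ i\<bar>) | Gaussian \<delta> \<Rightarrow> norm x)"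

definition gradient_gaps ::
  "mechanism \<Rightarrow> 'd list set \<Rightarrow> ('d list \<Rightarrow> real^'n \<Rightarrow> real^'n) \<Rightarrow> real^'n \<Rightarrow> real set" where
  "gradient_gaps m \<D> g u =
     {mechanism_norm m (g D u - g D' u) | D D'. D \<in> \<D> \<and> D' \<in> \<D> \<and> neighboring D D'}"

definition sensitivity ::
  "mechanism \<Rightarrow> 'd list set \<Rightarrow> ('d list \<Rightarrow> real^'n \<Rightarrow> real^'n) \<Rightarrow> real^'n \<Rightarrow> real" where
  "sensitivity m \<D> g u = Sup (gradient_gaps m \<D> g u)"

text \<open>The variance of one noise entry is \<open>variance_const m \<Delta> / \<epsilon>\<^sup>2\<close>.\<close>

definition variance_const :: "mechanism \<Rightarrow> real \<Rightarrow> real" where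
  "variance_const m \<Delta> = (case m of Laplace \<Rightarrow> 2 * \<Delta>\<^sup>2 | Gaussian \<delta> \<Rightarrow> 2 * ln (1.25 / \<delta>) * \<Delta>\<^sup>2)"

text \<open>Zero-mean laws on the real line; \<open>laplace_law b\<close> has scale \<open>b\<close>, hence variance \<open>2 b\<^sup>2\<close>.
  Scale zero (variance zero) is the point mass at the origin.\<close>

definition laplace_law :: "real \<Rightarrow> real measure" where
  "laplace_law b = (if b = 0 then return borel 0
     else density lborel (\<lambda>x. ennreal (exp (- \<bar>x\<bar> / b) / (2 * b))))"

definition gaussian_law :: "real \<Rightarrow> real measure" where
  "gaussian_law \<sigma> = (if \<sigma> = 0 then return borel 0
     else density lborel (\<lambda>x. ennreal (normal_density 0 \<sigma> x)))"

definition entry_law :: "mechanism \<Rightarrow> real \<Rightarrow> real \<Rightarrow> real measure" where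
  "entry_law m \<epsilon> \<Delta> = (case m of
       Laplace \<Rightarrow> laplace_law (\<Delta> / \<epsilon>)
     | Gaussian \<delta> \<Rightarrow> gaussian_law (sqrt (2 * ln (1.25 / \<delta>)) * (\<Delta> / \<epsilon>)))"

text \<open>All noise drawn up to local step \<open>e\<close> of round \<open>t\<close>, except for the draw of agent \<open>p\<close> at
  that very step. It determines the iterate at which agent \<open>p\<close> calibrates this draw.\<close>

definition other_draws :: "nat \<Rightarrow> nat \<Rightarrow> nat \<Rightarrow> 'p \<Rightarrow> (nat \<times> nat \<times> 'p) set" where
  "other_draws E t e p =
     {(s, d, q). 1 \<le> s \<and> d \<in> {1..E} \<and> (s < t \<or> s = t \<and> d \<le> e) \<and> (s, d, q) \<noteq> (t, e, p)}"

definition noise_history ::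
  "'w measure \<Rightarrow> nat \<Rightarrow> (nat \<Rightarrow> nat \<Rightarrow> 'p \<Rightarrow> 'w \<Rightarrow> real^'n) \<Rightarrow> nat \<Rightarrow> nat \<Rightarrow> 'p \<Rightarrow> 'w measure" where
  "noise_history M E \<xi> t e p = sigma (space M)
     {\<xi> s d q -` B \<inter> space M | s d q B. (s, d, q) \<in> other_draws E t e p \<and> B \<in> sets borel}"

text \<open>Fresh noise: conditionally on all other noise drawn so far, the entries of \<open>\<xi> t e p\<close> are
  independent and each has the law calibrated by the sensitivity \<open>\<Delta> p\<close> at the current iterate.\<close>

definition fresh_noise ::
  "'w measure \<Rightarrow> mechanism \<Rightarrow> real \<Rightarrow> nat \<Rightarrow> nat \<Rightarrow> ('p \<Rightarrow> real^'n \<Rightarrow> real) \<Rightarrow>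
   (nat \<Rightarrow> nat \<Rightarrow> 'w \<Rightarrow> (real^'n)^'p::finite) \<Rightarrow>
   (nat \<Rightarrow> nat \<Rightarrow> 'p \<Rightarrow> 'w \<Rightarrow> real^'n) \<Rightarrow> bool" where
  "fresh_noise M m \<epsilon> T E \<Delta> z \<xi> \<longleftrightarrow>
     (\<forall>t\<in>{1..T}. \<forall>e\<in>{1..E}. \<forall>p. \<xi> t e p \<in> borel_measurable M \<and>
       (\<forall>B. (\<forall>i. B i \<in> sets borel) \<longrightarrow>
         (AE \<omega> in M.
           real_cond_exp M (noise_history M E \<xi> t e p)
             (indicat_real {\<omega>'\<in>space M. \<forall>i. \<xi> t e p \<omega>' $ i \<in> B i}) \<omega>
           = (\<Prod>i\<in>UNIV. measure (entry_law m \<epsilon> (\<Delta> p (z t e \<omega> $ p))) (B i)))))"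

section \<open>The algorithm\<close>

text \<open>\<open>z t e\<close> is the local iterate \<open>z^{t,e}\<close>, whereas \<open>zb t\<close> is the averaged iterate \<open>z^t\<close>;
  \<open>g p\<close> is the selected subgradient of agent \<open>p\<close>.\<close>

definition dp_linearized_admm ::
  "('p \<Rightarrow> (real^'n) set) \<Rightarrow> ('p \<Rightarrow> real^'n \<Rightarrow> real^'n) \<Rightarrow> (nat \<Rightarrow> real) \<Rightarrow> (nat \<Rightarrow> real) \<Rightarrow>
   nat \<Rightarrow> nat \<Rightarrow> (real^'n)^'p::finite \<Rightarrow> (real^'n)^'p \<Rightarrow> (nat \<Rightarrow> nat \<Rightarrow> 'p \<Rightarrow> real^'n) \<Rightarrow>
   (nat \<Rightarrow> real^'n) \<Rightarrow> (nat \<Rightarrow> nat \<Rightarrow> (real^'n)^'p) \<Rightarrow> (nat \<Rightarrow> (real^'n)^'p) \<Rightarrow>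
   (nat \<Rightarrow> (real^'n)^'p) \<Rightarrow> bool" where
  "dp_linearized_admm W g \<rho> \<eta> T E lam1 z1 \<xi> w z zb lam \<longleftrightarrow>
     lam 1 = lam1 \<and> zb 1 = z1 \<and> z 0 (E + 1) = z1 \<and>
     (\<forall>t\<in>{1..T}.
        w (t + 1) = (1 / real CARD('p)) *\<^sub>R (\<Sum>p\<in>UNIV. zb t $ p - (1 / \<rho> t) *\<^sub>R lam t $ p) \<and>
        z t 1 = z (t - 1) (E + 1) \<and>
        (\<forall>e\<in>{1..E}. \<forall>p.
           is_arg_min
             (\<lambda>u. g p (z t e $ p) \<bullet> u
                  + 1 / (2 * \<eta> t) * (norm (u - z t e $ p))\<^sup>2
                  + \<rho> t / 2 * (norm (w (t + 1) - u + (1 / \<rho> t) *\<^sub>R (lam t $ p - \<xi> t e p)))\<^sup>2)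
             (\<lambda>u. u \<in> W p) (z t (e + 1) $ p)) \<and>
        zb (t + 1) = (1 / real E) *\<^sub>R (\<Sum>e = 1..E. z t (e + 1)) \<and>
        lam (t + 1) = lam t + \<rho> t *\<^sub>R (stack (w (t + 1)) - zb (t + 1)))"

text \<open>Averages with weights \<open>2 t / (T (T + 1))\<close>. Note that the local iterates enter with indices
  \<open>1..E\<close>, not \<open>2..E+1\<close> as in the averaged iterates of the algorithm.\<close>

definition z_avg :: "nat \<Rightarrow> nat \<Rightarrow> (nat \<Rightarrow> nat \<Rightarrow> 'a::real_vector) \<Rightarrow> 'a" where
  "z_avg T E z = (2 / (real T * (real T + 1))) *\<^sub>R
     (\<Sum>t = 1..T. real t *\<^sub>R ((1 / real E) *\<^sub>R (\<Sum>e = 1..E. z t e)))"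

definition w_avg :: "nat \<Rightarrow> (nat \<Rightarrow> 'a::real_vector) \<Rightarrow> 'a" where
  "w_avg T w = (2 / (real T * (real T + 1))) *\<^sub>R (\<Sum>t = 1..T. real t *\<^sub>R w (t + 1))"

section \<open>Constants of the bound\<close>

definition gradient_norms ::
  "('p \<Rightarrow> (real^'n) set) \<Rightarrow> ('p \<Rightarrow> real^'n \<Rightarrow> real^'n) \<Rightarrow> real set" where
  "gradient_norms W g = {norm (g p u) | p u. u \<in> W p}"

text \<open>Distances between stacked feasible points. Their supremum, and not the largest diameter of a
  single block, is the quantity that makes the convergence bound hold. With block diameters the bound
  fails, for instance, for 100 identical agents with \<open>n = 1\<close>, \<open>W p = {0..1}\<close>, \<open>f p x = x\<^sup>2 / 2\<close>,
  no noise, \<open>E = 1\<close>, \<open>T = 9\<close>, \<open>\<rho> t = 100\<close>, \<open>z1 = 1\<close>, \<open>lam1 = 0\<close>, \<open>\<gamma> = 10\<close>, \<open>\<alpha> = 1\<close>.\<close>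

definition stacked_distances :: "('p::finite \<Rightarrow> (real^'n) set) \<Rightarrow> real set" where
  "stacked_distances W =
     {norm (u - v) | u v :: (real^'n)^'p. u \<in> feasible_blocks W \<and> v \<in> feasible_blocks W}"

text \<open>All variance constants along all realizations of the iterates.\<close>

definition variance_consts ::
  "'w measure \<Rightarrow> mechanism \<Rightarrow> nat \<Rightarrow> nat \<Rightarrow> ('p \<Rightarrow> real^'n \<Rightarrow> real) \<Rightarrow>
   (nat \<Rightarrow> nat \<Rightarrow> 'w \<Rightarrow> (real^'n)^'p::finite) \<Rightarrow> real set" where
  "variance_consts M m T E \<Delta> z =
     {variance_const m (\<Delta> p (z t e \<omega> $ p)) | p t e \<omega>. t \<in> {1..T} \<and> e \<in> {1..E} \<and> \<omega> \<in> space M}"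

end

theory Submission
  imports Defs
begin

text \<open>
  The bound holds on almost every path up to terms that carry the noise, and these are controlled in
  expectation.

  On a path, each local step is a projection (\<open>local_step_is_projection\<close>), and its variational
  inequality together with strong convexity bounds the cost gap of the current iterate by a
  telescoping distance, a multiplier term and the noise (\<open>local_step_inequality\<close>). Averaged over the
  local steps, the multiplier terms turn into differences of squared distances of the multipliers
  and of the averaged iterates (\<open>consensus_round_inequality\<close>). Rounds are summed with weights \<open>t\<close>. The
  conditions on \<open>\<rho>\<close> keep the weights \<open>t * \<rho> t\<close> and \<open>t / \<rho> t\<close> from decreasing, and the step size
  \<open>2 / (\<alpha> * (t + 2))\<close> makes the quadratic weights telescope against strong convexity; hence every sum is
  at most of order \<open>T\<close>, and the normalization \<open>2 / (T * (T + 1))\<close> gives the rate (\<open>ergodic_gap_bound\<close>).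
  The argument compares with an arbitrary feasible consensus point and an arbitrary multiplier of norm at
  most \<open>\<gamma>\<close>; choosing the latter along the consensus violation produces the norm in the gap.

  In the noise terms the draw is paired with vectors that are determined by earlier draws
  (\<open>iterate_measurable\<close>). Because the noise is conditionally symmetric, these products have mean zero
  (\<open>integral_mult_conditionally_symmetric\<close>), and the remaining squared norms are bounded by comparing
  tails with the noise of largest variance (\<open>fresh_noise_entry_moments\<close>). With the multiplier entering no
  noise term, it may depend on the path.
\<close>

section \<open>The noise laws\<close>

text \<open>Both mechanisms only rescale one symmetric law of finite variance. This common form gives, for all
  sensitivities at once, the symmetry of the noise, the monotonicity of its tails in the sensitivity
  and its variance; scale zero yields the point mass at the origin.\<close>

definition unit_law :: "mechanism \<Rightarrow> real measure" where
  "unit_law m = (case m of Laplace \<Rightarrow> laplace_law 1 | Gaussian \<delta> \<Rightarrow> gaussian_law 1)"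

definition noise_scale :: "mechanism \<Rightarrow> real \<Rightarrow> real \<Rightarrow> real" where
  "noise_scale m \<epsilon> \<Delta> = (case m of Laplace \<Rightarrow> \<Delta> / \<epsilon>
     | Gaussian \<delta> \<Rightarrow> sqrt (2 * ln (1.25 / \<delta>)) * (\<Delta> / \<epsilon>))"

definition unit_variance :: "mechanism \<Rightarrow> real" where
  "unit_variance m = (case m of Laplace \<Rightarrow> 2 | Gaussian \<delta> \<Rightarrow> 1)"

lemma sets_unit_law [measurable_cong, simp]: "sets (unit_law m) = sets borel"
  by (simp add: unit_law_def laplace_law_def gaussian_law_def split: mechanism.split)

lemma space_unit_law [simp]: "space (unit_law m) = UNIV"
  using sets_eq_imp_space_eq[OF sets_unit_law[of m]] by simp

lemma scaled_density_eq_distr: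
  fixes h k :: "real \<Rightarrow> real"
  assumes [measurable]: "h \<in> borel_measurable borel"
    and b: "b > 0" and k: "\<And>x. k x = h (x / b) / b" and pos: "\<And>x. h x \<ge> 0"
  shows "density lborel k = distr (density lborel h) borel (\<lambda>x. b * x)" (is "?L = ?R")
proof (rule measure_eqI)
  have km [measurable]: "k \<in> borel_measurable borel"
    using k by (subst ext[of k "\<lambda>x. h (x / b) / b"]) auto
  fix A assume "A \<in> sets ?L"
  then have A [measurable]: "A \<in> sets borel" by simp
  have "emeasure ?L A = (\<integral>\<^sup>+x. ennreal (k x) * indicator A x \<partial>lborel)"
    by (simp add: emeasure_density)
  also have "\<dots> = \<bar>b\<bar> * (\<integral>\<^sup>+x. ennreal (k (0 + b * x)) * indicator A (0 + b * x) \<partial>lborel)"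
    using b by (intro nn_integral_real_affine) auto
  also have "\<dots> = (\<integral>\<^sup>+x. ennreal b * (ennreal (k (0 + b * x)) * indicator A (0 + b * x)) \<partial>lborel)"
    using b by (subst nn_integral_cmult) auto
  also have "\<dots> = (\<integral>\<^sup>+x. ennreal (h x) * indicator ((\<lambda>x. b * x) -` A) x \<partial>lborel)"
    using b pos
    by (intro nn_integral_cong) (auto simp: k indicator_def simp flip: ennreal_mult')
  also have "\<dots> = emeasure (density lborel h) ((\<lambda>x. b * x) -` A)"
  proof -
    have "(\<lambda>x. b * x) -` A \<in> sets borel"
      using measurable_sets[of "\<lambda>x. b * x" borel borel A] by simp
    then show ?thesis by (simp add: emeasure_density)
  qed
  also have "\<dots> = emeasure ?R A" by (subst emeasure_distr) auto
  finally show "emeasure ?L A = emeasure ?R A" .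
qed simp

text \<open>Each half line contributes half a Gamma integral. The case \<open>k = 0\<close> is the normalization of the
  density, the case \<open>k = 1\<close> its variance.\<close>

lemma has_bochner_integral_laplace:
  "has_bochner_integral lborel (\<lambda>x::real. exp (- \<bar>x\<bar>) / 2 * x ^ (2 * k)) (fact (2 * k))"
proof -
  have "has_bochner_integral lborel (\<lambda>x::real. indicator {0..} x *\<^sub>R (x ^ (2 * k) * exp (- x))) (fact (2 * k))"
  proof (rule has_bochner_integral_nn_integral)
    have "(\<integral>\<^sup>+x. ennreal (indicator {0..} x *\<^sub>R (x ^ (2 * k) * exp (- x))) \<partial>lborel)
        = (\<integral>\<^sup>+x. ennreal (x ^ (2 * k) * exp (- x)) * indicator {0..} x \<partial>lborel)"
      by (intro nn_integral_cong) (auto simp: indicator_def)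
    then show "(\<integral>\<^sup>+x. ennreal (indicator {0..} x *\<^sub>R (x ^ (2 * k) * exp (- x))) \<partial>lborel)
        = ennreal (fact (2 * k))"
      using nn_intergal_power_times_exp_Ici[of "2 * k"] by simp
  qed auto
  then have "has_bochner_integral lborel
      (\<lambda>x::real. indicator {0..} x *\<^sub>R (x ^ (2 * k) * exp (- x)) * (1 / 2)) (fact (2 * k) * (1 / 2))"
    by (rule has_bochner_integral_mult_left)
  also have "(\<lambda>x::real. indicator {0..} x *\<^sub>R (x ^ (2 * k) * exp (- x)) * (1 / 2))
      = (\<lambda>x. indicator {0..} x *\<^sub>R (exp (- \<bar>x\<bar>) / 2 * x ^ (2 * k)))"
    by (auto simp: indicator_def)
  finally have "has_bochner_integral lborel
      (\<lambda>x::real. indicator {0..} x *\<^sub>R (exp (- \<bar>x\<bar>) / 2 * x ^ (2 * k))) (fact (2 * k) * (1 / 2))" .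
  from has_bochner_integral_even_function[OF this] show ?thesis by simp
qed

lemma prob_space_unit_law: "prob_space (unit_law m)"
proof (cases m)
  case Laplace
  have "(\<integral>\<^sup>+x. ennreal (exp (- \<bar>x\<bar>) / 2) \<partial>lborel) = 1"
    using has_bochner_integral_laplace[of 0]
    by (subst nn_integral_eq_integral) (auto simp: has_bochner_integral_iff)
  then show ?thesis unfolding unit_law_def Laplace
    by (auto intro!: prob_spaceI simp: laplace_law_def emeasure_density)
next
  case (Gaussian \<delta>)
  then show ?thesis using prob_space_normal_density[of 1 0]
    by (simp add: unit_law_def gaussian_law_def)
qed

lemma nn_integral_square_unit_law:
  "(\<integral>\<^sup>+x. ennreal (x\<^sup>2) \<partial>unit_law m) = ennreal (unit_variance m)"
proof (cases m)
  case Laplace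
  have "(\<integral>\<^sup>+x. ennreal (x\<^sup>2) \<partial>unit_law m) = (\<integral>\<^sup>+x. ennreal (exp (- \<bar>x\<bar>) / 2 * x ^ (2 * 1)) \<partial>lborel)"
    by (simp add: Laplace unit_law_def laplace_law_def nn_integral_density flip: ennreal_mult')
  also have "\<dots> = ennreal 2"
    using has_bochner_integral_laplace[of 1]
    by (subst nn_integral_eq_integral) (auto simp: has_bochner_integral_iff)
  finally show ?thesis by (simp add: unit_variance_def Laplace)
next
  case (Gaussian \<delta>)
  have "(\<integral>\<^sup>+x. ennreal (x\<^sup>2) \<partial>unit_law m)
      = (\<integral>\<^sup>+x. ennreal (normal_density 0 1 x * (x - 0) ^ (2 * 1)) \<partial>lborel)"
    by (simp add: Gaussian unit_law_def gaussian_law_def nn_integral_density flip: ennreal_mult')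
  also have "\<dots> = ennreal 1"
    using normal_moment_even[of 1 0 1]
    by (subst nn_integral_eq_integral) (auto simp: has_bochner_integral_iff)
  finally show ?thesis by (simp add: unit_variance_def Gaussian)
qed

lemma distr_uminus_unit_law: "distr (unit_law m) borel uminus = unit_law m"
proof -
  have flip: "distr (density lborel h) borel uminus = density lborel h"
    if [measurable]: "h \<in> borel_measurable borel" and even: "\<And>x. h (- x) = h x" for h :: "real \<Rightarrow> ennreal"
  proof (rule measure_eqI)
    fix A assume "A \<in> sets (distr (density lborel h) borel uminus)"
    then have A [measurable]: "A \<in> sets borel" by simp
    have [measurable]: "uminus -` A \<in> sets borel"
      using measurable_sets[of "uminus :: real \<Rightarrow> real" borel borel A] by simp
    have "emeasure (distr (density lborel h) borel uminus) A
        = (\<integral>\<^sup>+x. h x * indicator (uminus -` A) x \<partial>lborel)"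
      by (simp add: emeasure_distr emeasure_density)
    also have "\<dots> = \<bar>-1::real\<bar> * (\<integral>\<^sup>+x. h (0 + -1 * x) * indicator (uminus -` A) (0 + -1 * x) \<partial>lborel)"
      by (intro nn_integral_real_affine) auto
    also have "\<dots> = (\<integral>\<^sup>+x. h x * indicator A x \<partial>lborel)"
      by (simp add: even indicator_def)
    also have "\<dots> = emeasure (density lborel h) A" by (simp add: emeasure_density)
    finally show "emeasure (distr (density lborel h) borel uminus) A = emeasure (density lborel h) A" .
  qed simp
  show ?thesis
    unfolding unit_law_def laplace_law_def gaussian_law_def
    by (auto split: mechanism.split intro!: flip simp: normal_density_def)
qed

lemma entry_law_eq_distr:
  assumes m: "valid_mechanism m" and \<epsilon>: "\<epsilon> > 0" and \<Delta>: "\<Delta> \<ge> 0"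
  shows "entry_law m \<epsilon> \<Delta> = distr (unit_law m) borel (\<lambda>x. noise_scale m \<epsilon> \<Delta> * x)"
proof -
  interpret prob_space "unit_law m" by (rule prob_space_unit_law)
  let ?b = "noise_scale m \<epsilon> \<Delta>"
  have law: "entry_law m \<epsilon> \<Delta> = (case m of Laplace \<Rightarrow> laplace_law ?b | Gaussian \<delta> \<Rightarrow> gaussian_law ?b)"
    by (simp add: entry_law_def noise_scale_def split: mechanism.split)
  have "?b \<ge> 0"
    using assms by (auto simp: noise_scale_def valid_mechanism_def split: mechanism.splits)
  then consider "?b = 0" | "?b > 0" by linarith
  then show ?thesis
  proof cases
    case 1
    have "distr (unit_law m) borel (\<lambda>x. 0) = return borel (0::real)"
    proof (rule measure_eqI)
      fix A assume "A \<in> sets (distr (unit_law m) borel (\<lambda>x. 0::real))"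
      then show "emeasure (distr (unit_law m) borel (\<lambda>x. 0)) A = emeasure (return borel 0) A"
        using emeasure_space_1 by (auto simp: emeasure_distr indicator_def)
    qed simp
    then show ?thesis using 1
      using law by (cases m) (simp_all add: laplace_law_def gaussian_law_def)
  next
    case 2
    have "laplace_law ?b = distr (laplace_law 1) borel (\<lambda>x. ?b * x)"
      using scaled_density_eq_distr[of "\<lambda>x. exp (- \<bar>x\<bar>) / 2" ?b "\<lambda>x. exp (- \<bar>x\<bar> / ?b) / (2 * ?b)"] 2
      by (simp add: laplace_law_def field_simps)
    moreover have "gaussian_law ?b = distr (gaussian_law 1) borel (\<lambda>x. ?b * x)"
      using scaled_density_eq_distr[of "normal_density 0 1" ?b "normal_density 0 ?b"] 2
      by (simp add: gaussian_law_def normal_density_def field_simps real_sqrt_mult)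
    ultimately show ?thesis using law by (cases m) (simp_all add: unit_law_def)
  qed
qed

text \<open>For a fixed \<open>B\<close> the sensitivity enters only through the factor on the right, so that probabilities
  of tails can be compared for different sensitivities on one and the same law.\<close>

lemma measure_entry_law:
  assumes "valid_mechanism m" "\<epsilon> > 0" "\<Delta> \<ge> 0" and [measurable]: "B \<in> sets borel"
  shows "measure (entry_law m \<epsilon> \<Delta>) B = measure (unit_law m) {x. noise_scale m \<epsilon> \<Delta> * x \<in> B}"
  unfolding entry_law_eq_distr[OF assms(1-3)]
  by (subst measure_distr) (auto simp: vimage_def)

lemma measure_entry_law_uminus:
  assumes "valid_mechanism m" "\<epsilon> > 0" "\<Delta> \<ge> 0" and [measurable]: "B \<in> sets borel"
  shows "measure (entry_law m \<epsilon> \<Delta>) (uminus -` B) = measure (entry_law m \<epsilon> \<Delta>) B"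
proof -
  have [measurable]: "uminus -` B \<in> sets borel"
    using measurable_sets[of "uminus :: real \<Rightarrow> real" borel borel B] by simp
  have "measure (entry_law m \<epsilon> \<Delta>) B = measure (distr (unit_law m) borel uminus) {x. noise_scale m \<epsilon> \<Delta> * x \<in> B}"
    by (simp add: measure_entry_law assms distr_uminus_unit_law)
  also have "\<dots> = measure (unit_law m) {x. noise_scale m \<epsilon> \<Delta> * x \<in> uminus -` B}"
    by (subst measure_distr) (auto simp: vimage_def)
  finally show ?thesis by (simp add: measure_entry_law assms)
qed

lemma noise_scale_square:
  assumes m: "valid_mechanism m" and \<epsilon>: "\<epsilon> > 0" and \<Delta>: "\<Delta> \<ge> 0"
  shows "(noise_scale m \<epsilon> \<Delta>)\<^sup>2 * unit_variance m = variance_const m \<Delta> / \<epsilon>\<^sup>2"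
  using assms
  by (auto simp: noise_scale_def unit_variance_def variance_const_def valid_mechanism_def
      power_mult_distrib power_divide split: mechanism.splits)

section \<open>Moments of noise with a prescribed conditional law\<close>

lemma nn_integral_eq_integral_tails:
  fixes X :: "'a \<Rightarrow> real"
  assumes "sigma_finite_measure M" and [measurable]: "X \<in> borel_measurable M"
  shows "(\<integral>\<^sup>+\<omega>. ennreal (X \<omega>) \<partial>M)
    = (\<integral>\<^sup>+s. emeasure M {\<omega> \<in> space M. X \<omega> > s} * indicator {0..} s \<partial>lborel)"
proof -
  interpret M: sigma_finite_measure M by fact
  interpret pair_sigma_finite lborel M ..
  have "(\<integral>\<^sup>+\<omega>. ennreal (X \<omega>) \<partial>M) = (\<integral>\<^sup>+\<omega>. (\<integral>\<^sup>+s. indicator {0..<X \<omega>} s \<partial>lborel) \<partial>M)"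
  proof (intro nn_integral_cong)
    fix \<omega>
    show "ennreal (X \<omega>) = (\<integral>\<^sup>+s. indicator {0..<X \<omega>} s \<partial>lborel)"
      by (cases "0 \<le> X \<omega>") (simp_all add: ennreal_neg)
  qed
  also have "\<dots> = (\<integral>\<^sup>+\<omega>. (\<integral>\<^sup>+s. indicator {s. 0 \<le> s \<and> s < X \<omega>} s \<partial>lborel) \<partial>M)"
    by (intro nn_integral_cong) (auto simp: indicator_def)
  also have "\<dots> = (\<integral>\<^sup>+s. (\<integral>\<^sup>+\<omega>. indicator {s. 0 \<le> s \<and> s < X \<omega>} s \<partial>M) \<partial>lborel)"
    by (rule Fubini') measurable
  also have "\<dots> = (\<integral>\<^sup>+s. emeasure M {\<omega> \<in> space M. X \<omega> > s} * indicator {0..} s \<partial>lborel)"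
  proof (intro nn_integral_cong)
    fix s :: real
    have "(\<integral>\<^sup>+\<omega>. indicator {s. 0 \<le> s \<and> s < X \<omega>} s \<partial>M)
        = (\<integral>\<^sup>+\<omega>. indicator {0..} s * indicator {\<omega> \<in> space M. X \<omega> > s} \<omega> \<partial>M)"
      by (intro nn_integral_cong) (auto simp: indicator_def)
    also have "\<dots> = indicator {0..} s * emeasure M {\<omega> \<in> space M. X \<omega> > s}"
      by (subst nn_integral_cmult) auto
    finally show "(\<integral>\<^sup>+\<omega>. indicator {s. 0 \<le> s \<and> s < X \<omega>} s \<partial>M)
        = emeasure M {\<omega> \<in> space M. X \<omega> > s} * indicator {0..} s"
      by (simp add: mult.commute)
  qed
  finally show ?thesis .
qed

text \<open>Layer-cake comparison. A comparison of tails needs only the probabilities of single events, whereas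
  the sensitivity, a supremum over possibly uncountably many pairs of datasets, need not depend
  measurably on the iterate; hence second moments cannot be obtained by integrating a conditional
  variance.\<close>

lemma nn_integral_mono_tails:
  fixes X :: "'a \<Rightarrow> real" and Y :: "'b \<Rightarrow> real"
  assumes M: "finite_measure M" and N: "finite_measure N"
    and X: "X \<in> borel_measurable M" and Y: "Y \<in> borel_measurable N"
    and tails: "\<And>s. s \<ge> 0 \<Longrightarrow> measure M {\<omega> \<in> space M. X \<omega> > s} \<le> measure N {\<omega> \<in> space N. Y \<omega> > s}"
  shows "(\<integral>\<^sup>+\<omega>. ennreal (X \<omega>) \<partial>M) \<le> (\<integral>\<^sup>+\<omega>. ennreal (Y \<omega>) \<partial>N)"
proof -
  interpret M: finite_measure M by fact
  interpret N: finite_measure N by fact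
  show ?thesis
    unfolding nn_integral_eq_integral_tails[OF M.sigma_finite_measure_axioms X]
      nn_integral_eq_integral_tails[OF N.sigma_finite_measure_axioms Y]
    using tails
    by (intro nn_integral_mono)
      (auto simp: indicator_def M.emeasure_eq_measure N.emeasure_eq_measure ennreal_leI)
qed

text \<open>If \<open>X\<close> and \<open>-X\<close> have the same conditional law, then on every event of \<open>F\<close> they have the same
  distribution, so the integral of \<open>X\<close> over this event equals its own negative. Thus the conditional
  expectation of \<open>X\<close> vanishes, and an \<open>F\<close>-measurable factor can be pulled out of it.\<close>

lemma integral_mult_conditionally_symmetric:
  fixes X h :: "'a \<Rightarrow> real"
  assumes M: "prob_space M" and F: "subalgebra M F"
    and X: "integrable M X" and hX: "integrable M (\<lambda>\<omega>. h \<omega> * X \<omega>)" and h: "h \<in> borel_measurable F"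
    and sym: "\<And>B. B \<in> sets borel \<Longrightarrow> AE \<omega> in M.
      real_cond_exp M F (indicat_real {\<omega>\<in>space M. X \<omega> \<in> uminus -` B}) \<omega>
      = real_cond_exp M F (indicat_real {\<omega>\<in>space M. X \<omega> \<in> B}) \<omega>"
  shows "(\<integral>\<omega>. h \<omega> * X \<omega> \<partial>M) = 0"
proof -
  interpret prob_space M by fact
  interpret finite_measure_subalgebra M F by unfold_locales (rule F)
  have Xm [measurable]: "X \<in> borel_measurable M" using X by simp
  have "(\<integral>\<omega>\<in>A. X \<omega> \<partial>M) = (\<integral>\<omega>\<in>A. 0 \<partial>M)" if A: "A \<in> sets F" for A
  proof -
    have AM [measurable]: "A \<in> sets M" using A F by (auto simp: subalgebra_def)
    have prob_A: "measure M (A \<inter> {\<omega>\<in>space M. X \<omega> \<in> B})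
        = (\<integral>\<omega>\<in>A. real_cond_exp M F (indicat_real {\<omega>\<in>space M. X \<omega> \<in> B}) \<omega> \<partial>M)"
      if [measurable]: "B \<in> sets borel" for B
    proof -
      have "measure M (A \<inter> {\<omega>\<in>space M. X \<omega> \<in> B}) = (\<integral>\<omega>\<in>A. indicat_real {\<omega>\<in>space M. X \<omega> \<in> B} \<omega> \<partial>M)"
        by (simp add: set_lebesgue_integral_def flip: indicator_inter_arith)
      also have "\<dots> = (\<integral>\<omega>\<in>A. real_cond_exp M F (indicat_real {\<omega>\<in>space M. X \<omega> \<in> B}) \<omega> \<partial>M)"
        by (rule real_cond_exp_intA[OF _ A])
          (intro integrable_real_indicator, auto simp: emeasure_eq_measure)
      finally show ?thesis .
    qed
    have flip: "measure M (A \<inter> {\<omega>\<in>space M. X \<omega> \<in> uminus -` B}) = measure M (A \<inter> {\<omega>\<in>space M. X \<omega> \<in> B})"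
      if B [measurable]: "B \<in> sets borel" for B
    proof -
      have [measurable]: "uminus -` B \<in> sets borel"
        using measurable_sets[of "uminus :: real \<Rightarrow> real" borel borel B] by simp
      have "(\<integral>\<omega>\<in>A. real_cond_exp M F (indicat_real {\<omega>\<in>space M. X \<omega> \<in> uminus -` B}) \<omega> \<partial>M)
          = (\<integral>\<omega>\<in>A. real_cond_exp M F (indicat_real {\<omega>\<in>space M. X \<omega> \<in> B}) \<omega> \<partial>M)"
        unfolding set_lebesgue_integral_def using sym[OF B]
        by (intro integral_cong_AE) auto
      then show ?thesis by (simp only: prob_A[OF B] prob_A[OF \<open>uminus -` B \<in> sets borel\<close>])
    qed
    define N where "N = density M (\<lambda>\<omega>. ennreal (indicat_real A \<omega>))"
    have N: "emeasure N (X' -` B \<inter> space N) = measure M (A \<inter> {\<omega>\<in>space M. X' \<omega> \<in> B})"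
      if [measurable]: "B \<in> sets borel" "X' \<in> borel_measurable M" for X' :: "'a \<Rightarrow> real" and B
    proof -
      have "emeasure N (X' -` B \<inter> space N) = (\<integral>\<^sup>+\<omega>. indicator A \<omega> * indicator (X' -` B \<inter> space M) \<omega> \<partial>M)"
        unfolding N_def by (subst emeasure_density) (auto simp: ennreal_indicator)
      also have "\<dots> = (\<integral>\<^sup>+\<omega>. indicator (A \<inter> {\<omega>\<in>space M. X' \<omega> \<in> B}) \<omega> \<partial>M)"
        by (intro nn_integral_cong) (auto simp: indicator_def)
      also have "\<dots> = measure M (A \<inter> {\<omega>\<in>space M. X' \<omega> \<in> B})"
        by (subst nn_integral_indicator) (auto simp: emeasure_eq_measure)
      finally show ?thesis .
    qed
    have meas_N [measurable]: "X \<in> borel_measurable N" by (simp add: N_def)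
    have "distr N borel X = distr N borel (\<lambda>\<omega>. - X \<omega>)"
    proof (rule measure_eqI)
      fix B assume "B \<in> sets (distr N borel X)"
      then have [measurable]: "B \<in> sets borel" by simp
      show "emeasure (distr N borel X) B = emeasure (distr N borel (\<lambda>\<omega>. - X \<omega>)) B"
        using flip[of B] by (simp add: emeasure_distr N)
    qed simp
    then have "(\<integral>x. x \<partial>distr N borel X) = (\<integral>x. x \<partial>distr N borel (\<lambda>\<omega>. - X \<omega>))" by simp
    then have "(\<integral>\<omega>. X \<omega> \<partial>N) = (\<integral>\<omega>. - X \<omega> \<partial>N)" by (simp add: integral_distr)
    then have "(\<integral>\<omega>. X \<omega> \<partial>N) = 0" by simp
    then show ?thesis
      by (simp add: N_def set_lebesgue_integral_def integral_density)
  qed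
  then have "AE \<omega> in M. real_cond_exp M F X \<omega> = 0"
    using X by (intro real_cond_exp_charact) auto
  then have "(\<integral>\<omega>. h \<omega> * real_cond_exp M F X \<omega> \<partial>M) = (\<integral>\<omega>. 0 \<partial>M)"
    using measurable_from_subalg[OF F h] by (intro integral_cong_AE) auto
  then show ?thesis using real_cond_exp_intg(2)[OF hX h Xm] by simp
qed

lemma subalgebra_noise_history:
  assumes "\<And>s d q. (s, d, q) \<in> other_draws E t e p \<Longrightarrow> \<xi> s d q \<in> borel_measurable M"
  shows "subalgebra M (noise_history M E \<xi> t e p)"
proof -
  let ?G = "{\<xi> s d q -` B \<inter> space M | s d q B. (s, d, q) \<in> other_draws E t e p \<and> B \<in> sets borel}"
  have "?G \<subseteq> sets M" using assms by (auto intro: measurable_sets)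
  then have "sigma_sets (space M) ?G \<subseteq> sets M" by (rule sets.sigma_sets_subset)
  moreover have "sets (noise_history M E \<xi> t e p) = sigma_sets (space M) ?G"
    unfolding noise_history_def by (rule sets_measure_of) auto
  moreover have "space (noise_history M E \<xi> t e p) = space M"
    unfolding noise_history_def by (rule space_measure_of) auto
  ultimately show ?thesis by (simp add: subalgebra_def)
qed

lemma noise_history_measurable:
  fixes \<xi> :: "nat \<Rightarrow> nat \<Rightarrow> 'p \<Rightarrow> 'w \<Rightarrow> real^'n"
  assumes "(s, d, q) \<in> other_draws E t e p"
  shows "\<xi> s d q \<in> borel_measurable (noise_history M E \<xi> t e p)"
proof (rule measurableI)
  fix B :: "(real^'n) set" assume "B \<in> sets borel"
  then show "\<xi> s d q -` B \<inter> space (noise_history M E \<xi> t e p) \<in> sets (noise_history M E \<xi> t e p)"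
    using assms unfolding noise_history_def
    by (subst sets_measure_of, blast, subst space_measure_of, blast) (blast intro: sigma_sets.Basic)
qed simp

lemma space_noise_history [simp]: "space (noise_history M E \<xi> t e p) = space M"
  unfolding noise_history_def by (rule space_measure_of) auto

text \<open>Marginals of the conditional law on rectangles: the other coordinates are left free.\<close>

lemma fresh_noise_entry_law:
  fixes \<Delta> :: "'p::finite \<Rightarrow> real^'n \<Rightarrow> real"
  assumes noise: "fresh_noise M m \<epsilon> T E \<Delta> z \<xi>" and te: "t \<in> {1..T}" "e \<in> {1..E}"
    and m: "valid_mechanism m" "\<epsilon> > 0" and \<Delta>: "\<And>\<omega>. \<omega> \<in> space M \<Longrightarrow> 0 \<le> \<Delta> p (z t e \<omega> $ p)"
    and B: "B \<in> sets borel"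
  shows "AE \<omega> in M. real_cond_exp M (noise_history M E \<xi> t e p)
      (indicat_real {\<omega>\<in>space M. \<xi> t e p \<omega> $ i \<in> B}) \<omega>
    = measure (entry_law m \<epsilon> (\<Delta> p (z t e \<omega> $ p))) B"
proof -
  define C where "C = (\<lambda>j::'n. if j = i then B else UNIV)"
  have "AE \<omega> in M. real_cond_exp M (noise_history M E \<xi> t e p)
      (indicat_real {\<omega>\<in>space M. \<forall>j. \<xi> t e p \<omega> $ j \<in> C j}) \<omega>
    = (\<Prod>j\<in>UNIV. measure (entry_law m \<epsilon> (\<Delta> p (z t e \<omega> $ p))) (C j))"
  proof -
    have "\<forall>j. C j \<in> sets borel" using B by (simp add: C_def)
    then show ?thesis using noise te unfolding fresh_noise_def by blast
  qed
  moreover have "{\<omega>\<in>space M. \<forall>j. \<xi> t e p \<omega> $ j \<in> C j} = {\<omega>\<in>space M. \<xi> t e p \<omega> $ i \<in> B}"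
    by (auto simp: C_def)
  moreover have "(\<Prod>j\<in>UNIV. measure (entry_law m \<epsilon> (\<Delta> p (z t e \<omega> $ p))) (C j))
      = measure (entry_law m \<epsilon> (\<Delta> p (z t e \<omega> $ p))) B" if \<omega>: "\<omega> \<in> space M" for \<omega>
  proof -
    interpret prob_space "unit_law m" by (rule prob_space_unit_law)
    have "measure (entry_law m \<epsilon> (\<Delta> p (z t e \<omega> $ p))) UNIV = 1"
      using prob_space by (simp add: measure_entry_law m \<Delta>[OF \<omega>])
    then have "measure (entry_law m \<epsilon> (\<Delta> p (z t e \<omega> $ p))) (C j)
        = (if j = i then measure (entry_law m \<epsilon> (\<Delta> p (z t e \<omega> $ p))) B else 1)" for j
      by (simp add: C_def)
    then show ?thesis by (simp only: prod.delta finite UNIV_I if_True)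
  qed
  ultimately show ?thesis
    by (simp cong: AE_cong)
qed

text \<open>The tails of a noise entry are dominated by those of the unit law scaled by \<open>\<sigma>\<close>, the scale whose
  variance is exactly \<open>V / \<epsilon>\<^sup>2\<close>; this bounds the second moment. The entry is conditionally symmetric,
  so it is uncorrelated with everything bounded that is known before the draw.\<close>

lemma fresh_noise_entry_moments:
  fixes \<Delta> :: "'p::finite \<Rightarrow> real^'n \<Rightarrow> real"
  assumes M: "prob_space M"
    and noise: "fresh_noise M m \<epsilon> T E \<Delta> z \<xi>" and te: "t \<in> {1..T}" "e \<in> {1..E}"
    and m: "valid_mechanism m" "\<epsilon> > 0" and \<Delta>: "\<And>\<omega>. \<omega> \<in> space M \<Longrightarrow> 0 \<le> \<Delta> p (z t e \<omega> $ p)"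
    and V: "\<And>\<omega>. \<omega> \<in> space M \<Longrightarrow> variance_const m (\<Delta> p (z t e \<omega> $ p)) \<le> V"
  shows "integrable M (\<lambda>\<omega>. (\<xi> t e p \<omega> $ i)\<^sup>2)" (is ?int)
    and "(\<integral>\<omega>. (\<xi> t e p \<omega> $ i)\<^sup>2 \<partial>M) \<le> V / \<epsilon>\<^sup>2" (is ?bound)
    and "\<And>h. h \<in> borel_measurable (noise_history M E \<xi> t e p) \<Longrightarrow> (\<And>\<omega>. \<omega> \<in> space M \<Longrightarrow> \<bar>h \<omega>\<bar> \<le> K) \<Longrightarrow>
      integrable M (\<lambda>\<omega>. h \<omega> * \<xi> t e p \<omega> $ i) \<and> (\<integral>\<omega>. h \<omega> * \<xi> t e p \<omega> $ i \<partial>M) = 0"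
proof -
  interpret prob_space M by fact
  let ?F = "noise_history M E \<xi> t e p"
  let ?X = "\<lambda>\<omega>. \<xi> t e p \<omega> $ i"
  have \<xi>: "\<xi> s d q \<in> borel_measurable M" if "s \<in> {1..T}" "d \<in> {1..E}" for s d q
    using noise that by (auto simp: fresh_noise_def)
  have F: "subalgebra M ?F"
    using te by (intro subalgebra_noise_history \<xi>) (auto simp: other_draws_def)
  interpret finite_measure_subalgebra M ?F by unfold_locales (rule F)
  have [measurable]: "\<xi> t e p \<in> borel_measurable M" by (rule \<xi>[OF te])
  have X [measurable]: "?X \<in> borel_measurable M"
    by (rule measurable_compose[OF \<open>\<xi> t e p \<in> borel_measurable M\<close>])
      (intro borel_measurable_continuous_onI continuous_intros)
  interpret U: prob_space "unit_law m" by (rule prob_space_unit_law)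
  have uv: "unit_variance m > 0" by (simp add: unit_variance_def split: mechanism.split)
  define \<sigma> where "\<sigma> = sqrt (V / \<epsilon>\<^sup>2 / unit_variance m)"
  have scale': "(noise_scale m \<epsilon> (\<Delta> p (z t e \<omega> $ p)))\<^sup>2 \<le> V / \<epsilon>\<^sup>2 / unit_variance m" if "\<omega> \<in> space M" for \<omega>
    using V[OF that] noise_scale_square[OF m \<Delta>[OF that]] uv m
    by (simp add: field_simps)
  moreover obtain \<omega>\<^sub>0 where "\<omega>\<^sub>0 \<in> space M" using not_empty by blast
  ultimately have V0: "0 \<le> V / \<epsilon>\<^sup>2 / unit_variance m"
    using order_trans[OF zero_le_power2] by blast
  then have scale: "(noise_scale m \<epsilon> (\<Delta> p (z t e \<omega> $ p)))\<^sup>2 \<le> \<sigma>\<^sup>2" if "\<omega> \<in> space M" for \<omega>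
    using scale'[OF that] unfolding \<sigma>_def by (simp only: real_sqrt_pow2)
  have law: "AE \<omega> in M. real_cond_exp M ?F (indicat_real {\<omega>\<in>space M. ?X \<omega> \<in> B}) \<omega>
      = measure (entry_law m \<epsilon> (\<Delta> p (z t e \<omega> $ p))) B" if "B \<in> sets borel" for B
    by (rule fresh_noise_entry_law[where M = M and \<Delta> = \<Delta> and z = z, OF noise te m _ that]) (rule \<Delta>)
  have tail: "prob {\<omega>\<in>space M. (?X \<omega>)\<^sup>2 > s} \<le> measure (unit_law m) {x \<in> space (unit_law m). (\<sigma> * x)\<^sup>2 > s}" for s
  proof -
    let ?B = "{x::real. x\<^sup>2 > s}"
    have "prob {\<omega>\<in>space M. (?X \<omega>)\<^sup>2 > s} = (\<integral>\<omega>. indicat_real {\<omega>\<in>space M. ?X \<omega> \<in> ?B} \<omega> \<partial>M)" by simp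
    also have "\<dots> = (\<integral>\<omega>. real_cond_exp M ?F (indicat_real {\<omega>\<in>space M. ?X \<omega> \<in> ?B}) \<omega> \<partial>M)"
      by (rule real_cond_exp_int(2)[symmetric])
        (intro integrable_real_indicator, auto simp: emeasure_eq_measure)
    also have "\<dots> \<le> (\<integral>\<omega>. measure (unit_law m) {x \<in> space (unit_law m). (\<sigma> * x)\<^sup>2 > s} \<partial>M)"
    proof (rule integral_mono_AE)
      show "integrable M (real_cond_exp M ?F (indicat_real {\<omega>\<in>space M. ?X \<omega> \<in> ?B}))"
        by (rule real_cond_exp_int(1))
          (intro integrable_real_indicator, auto simp: emeasure_eq_measure)
      have "measure (entry_law m \<epsilon> (\<Delta> p (z t e \<omega> $ p))) ?B
          \<le> measure (unit_law m) {x \<in> space (unit_law m). (\<sigma> * x)\<^sup>2 > s}" if \<omega>: "\<omega> \<in> space M" for \<omega>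
      proof -
        have "(noise_scale m \<epsilon> (\<Delta> p (z t e \<omega> $ p)) * x)\<^sup>2 \<le> (\<sigma> * x)\<^sup>2" for x
          unfolding power_mult_distrib using scale[OF \<omega>] by (intro mult_right_mono) auto
        then show ?thesis
          by (subst measure_entry_law[OF m \<Delta>[OF \<omega>]])
            (auto intro!: U.finite_measure_mono intro: less_le_trans)
      qed
      then show "AE \<omega> in M. real_cond_exp M ?F (indicat_real {\<omega>\<in>space M. ?X \<omega> \<in> ?B}) \<omega>
          \<le> measure (unit_law m) {x \<in> space (unit_law m). (\<sigma> * x)\<^sup>2 > s}"
        using law[of ?B]
        by (auto elim!: AE_mp)
    qed simp
    finally show ?thesis by (simp add: prob_space)
  qed
  have "(\<integral>\<^sup>+\<omega>. ennreal ((?X \<omega>)\<^sup>2) \<partial>M) \<le> (\<integral>\<^sup>+x. ennreal ((\<sigma> * x)\<^sup>2) \<partial>unit_law m)"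
    using tail by (intro nn_integral_mono_tails finite_measure_axioms U.finite_measure_axioms) auto
  also have "\<dots> = ennreal (\<sigma>\<^sup>2) * (\<integral>\<^sup>+x. ennreal (x\<^sup>2) \<partial>unit_law m)"
    by (subst nn_integral_cmult[symmetric]) (auto simp: power_mult_distrib ennreal_mult')
  also have "\<dots> = ennreal (V / \<epsilon>\<^sup>2)"
    using uv V0 unfolding nn_integral_square_unit_law \<sigma>_def by (simp flip: ennreal_mult')
  finally have nn: "(\<integral>\<^sup>+\<omega>. ennreal ((?X \<omega>)\<^sup>2) \<partial>M) \<le> ennreal (V / \<epsilon>\<^sup>2)" .
  show int: ?int
    using nn by (intro integrableI_nonneg) (auto simp: top_unique less_top[symmetric])
  show ?bound
  proof -
    have "0 \<le> V / \<epsilon>\<^sup>2"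
      using mult_nonneg_nonneg[OF V0 less_imp_le[OF uv]] uv by simp
    then show ?thesis using nn by (subst (asm) nn_integral_eq_integral[OF int]) simp_all
  qed
  have Xint: "integrable M ?X" by (rule square_integrable_imp_integrable[OF X int])
  fix h assume h: "h \<in> borel_measurable ?F" and K: "\<And>\<omega>. \<omega> \<in> space M \<Longrightarrow> \<bar>h \<omega>\<bar> \<le> K"
  have hM [measurable]: "h \<in> borel_measurable M" by (rule measurable_from_subalg[OF F h])
  have hX: "integrable M (\<lambda>\<omega>. h \<omega> * ?X \<omega>)"
  proof (rule Bochner_Integration.integrable_bound)
    show "integrable M (\<lambda>\<omega>. K * ?X \<omega>)" using Xint by simp
    show "AE \<omega> in M. norm (h \<omega> * ?X \<omega>) \<le> norm (K * ?X \<omega>)"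
      using K by (intro AE_I2) (auto simp: abs_mult intro!: mult_right_mono intro: order_trans abs_ge_self)
  qed simp
  moreover have "(\<integral>\<omega>. h \<omega> * ?X \<omega> \<partial>M) = 0"
  proof (rule integral_mult_conditionally_symmetric[OF M F Xint hX h])
    fix B :: "real set" assume B [measurable]: "B \<in> sets borel"
    have B': "uminus -` B \<in> sets borel"
      using measurable_sets[of "uminus :: real \<Rightarrow> real" borel borel B] by simp
    show "AE \<omega> in M. real_cond_exp M ?F (indicat_real {\<omega>\<in>space M. ?X \<omega> \<in> uminus -` B}) \<omega>
        = real_cond_exp M ?F (indicat_real {\<omega>\<in>space M. ?X \<omega> \<in> B}) \<omega>"
      using law[OF B] law[OF B'] AE_space
      by eventually_elim (simp add: measure_entry_law_uminus[OF m \<Delta> B])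
  qed
  ultimately show "integrable M (\<lambda>\<omega>. h \<omega> * ?X \<omega>) \<and> (\<integral>\<omega>. h \<omega> * ?X \<omega> \<partial>M) = 0" by blast
qed

text \<open>With \<open>h\<close> a deviation of the iterate this removes the linear noise term from the expected bound; with
  \<open>h\<close> the subgradient it bounds the second moment of the perturbed subgradient, the cross term
  being of the same linear kind.\<close>

lemma fresh_noise_vector_moments:
  fixes \<Delta> :: "'p::finite \<Rightarrow> real^'n \<Rightarrow> real" and h :: "'w \<Rightarrow> real^'n"
  assumes M: "prob_space M"
    and noise: "fresh_noise M m \<epsilon> T E \<Delta> z \<xi>" and te: "t \<in> {1..T}" "e \<in> {1..E}"
    and m: "valid_mechanism m" "\<epsilon> > 0" and \<Delta>: "\<And>\<omega>. \<omega> \<in> space M \<Longrightarrow> 0 \<le> \<Delta> p (z t e \<omega> $ p)"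
    and V: "\<And>\<omega>. \<omega> \<in> space M \<Longrightarrow> variance_const m (\<Delta> p (z t e \<omega> $ p)) \<le> V"
    and h: "h \<in> borel_measurable (noise_history M E \<xi> t e p)"
    and K: "\<And>\<omega>. \<omega> \<in> space M \<Longrightarrow> norm (h \<omega>) \<le> K"
  shows "integrable M (\<lambda>\<omega>. \<xi> t e p \<omega> \<bullet> h \<omega>)" "(\<integral>\<omega>. \<xi> t e p \<omega> \<bullet> h \<omega> \<partial>M) = 0"
    and "integrable M (\<lambda>\<omega>. (norm (h \<omega> + \<xi> t e p \<omega>))\<^sup>2)"
    and "(\<integral>\<omega>. (norm (h \<omega> + \<xi> t e p \<omega>))\<^sup>2 \<partial>M) \<le> K\<^sup>2 + real CARD('n) * V / \<epsilon>\<^sup>2"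
proof -
  interpret prob_space M by fact
  let ?F = "noise_history M E \<xi> t e p"
  let ?X = "\<xi> t e p"
  have F: "subalgebra M ?F"
    using te noise by (intro subalgebra_noise_history) (auto simp: other_draws_def fresh_noise_def)
  have hM [measurable]: "h \<in> borel_measurable M" by (rule measurable_from_subalg[OF F h])
  have hi: "(\<lambda>\<omega>. h \<omega> $ i) \<in> borel_measurable ?F" for i
    by (rule measurable_compose[OF h]) (intro borel_measurable_continuous_onI continuous_intros)
  have Ki: "\<bar>h \<omega> $ i\<bar> \<le> K" if "\<omega> \<in> space M" for \<omega> i
    using component_le_norm_cart[of "h \<omega>" i] K[OF that] by linarith
  note entry = fresh_noise_entry_moments[where M = M and \<Delta> = \<Delta> and z = z, OF M noise te m \<Delta> V]
  have cross: "integrable M (\<lambda>\<omega>. h \<omega> $ i * ?X \<omega> $ i) \<and> (\<integral>\<omega>. h \<omega> $ i * ?X \<omega> $ i \<partial>M) = 0" for i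
    by (rule entry(3)[OF _ _ hi Ki])
  have inner: "?X \<omega> \<bullet> h \<omega> = (\<Sum>i\<in>UNIV. h \<omega> $ i * ?X \<omega> $ i)" for \<omega>
    by (simp add: inner_vec_def mult.commute)
  show int: "integrable M (\<lambda>\<omega>. ?X \<omega> \<bullet> h \<omega>)" unfolding inner using cross by simp
  show zero: "(\<integral>\<omega>. ?X \<omega> \<bullet> h \<omega> \<partial>M) = 0" unfolding inner using cross by simp
  have hint: "integrable M (\<lambda>\<omega>. (norm (h \<omega>))\<^sup>2)"
    using K by (intro integrable_const_bound[of _ "K\<^sup>2"]) (auto intro!: AE_I2 power_mono)
  have square: "(norm (h \<omega> + ?X \<omega>))\<^sup>2
      = (norm (h \<omega>))\<^sup>2 + 2 * (?X \<omega> \<bullet> h \<omega>) + (\<Sum>i\<in>UNIV. (?X \<omega> $ i)\<^sup>2)" for \<omega>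
  proof -
    have "(\<Sum>i\<in>UNIV. (?X \<omega> $ i)\<^sup>2) = ?X \<omega> \<bullet> ?X \<omega>" by (simp add: inner_vec_def power2_eq_square)
    then show ?thesis unfolding power2_norm_eq_inner by (simp add: inner_simps inner_commute)
  qed
  show "integrable M (\<lambda>\<omega>. (norm (h \<omega> + ?X \<omega>))\<^sup>2)"
    unfolding square using hint int entry(1) by (intro Bochner_Integration.integrable_add integrable_sum) auto
  have "(\<integral>\<omega>. (norm (h \<omega> + ?X \<omega>))\<^sup>2 \<partial>M)
      = (\<integral>\<omega>. (norm (h \<omega>))\<^sup>2 \<partial>M) + 2 * (\<integral>\<omega>. ?X \<omega> \<bullet> h \<omega> \<partial>M) + (\<Sum>i\<in>UNIV. \<integral>\<omega>. (?X \<omega> $ i)\<^sup>2 \<partial>M)"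
    unfolding square using hint int entry(1) by simp
  also have "\<dots> \<le> K\<^sup>2 + 2 * 0 + (\<Sum>i\<in>(UNIV :: 'n set). V / \<epsilon>\<^sup>2)"
  proof (intro add_mono sum_mono entry(2))
    have "(\<integral>\<omega>. (norm (h \<omega>))\<^sup>2 \<partial>M) \<le> (\<integral>\<omega>. K\<^sup>2 \<partial>M)"
      using hint K by (intro integral_mono) (auto intro!: power_mono)
    then show "(\<integral>\<omega>. (norm (h \<omega>))\<^sup>2 \<partial>M) \<le> K\<^sup>2" by (simp add: prob_space)
  qed (simp add: zero)
  finally show "(\<integral>\<omega>. (norm (h \<omega> + ?X \<omega>))\<^sup>2 \<partial>M) \<le> K\<^sup>2 + real CARD('n) * V / \<epsilon>\<^sup>2" by simp
qed

section \<open>Convex analysis\<close>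

text \<open>The subgradient inequality at \<open>(1 - v) x + v y\<close> and strong convexity give, after division by \<open>v\<close>,
  the claim with the quadratic term multiplied by \<open>1 - v\<close>; then \<open>v\<close> tends to zero.\<close>

lemma strong_subgradient_inequality:
  assumes sc: "strongly_convex_on \<alpha> S f" and sg: "is_subgradient S f x g" and y: "y \<in> S"
  shows "f x - f y \<le> g \<bullet> (x - y) - \<alpha> / 2 * (norm (x - y))\<^sup>2"
proof -
  have x: "x \<in> S" using sg by (simp add: is_subgradient_def)
  have scaled: "f x - f y \<le> g \<bullet> (x - y) - (1 - v) * (\<alpha> / 2 * (norm (x - y))\<^sup>2)"
    if v: "0 < v" "v < 1" for v
  proof -
    let ?c = "(1 - v) *\<^sub>R x + v *\<^sub>R y"
    have cvx: "convex S" using sc by (simp add: strongly_convex_on_def)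
    have "?c \<in> S" using convexD[OF cvx x y, of "1 - v" v] v by simp
    then have "f ?c \<ge> f x + g \<bullet> (?c - x)" using sg by (simp add: is_subgradient_def)
    moreover have "?c - x = v *\<^sub>R (y - x)" by (simp add: algebra_simps)
    moreover have "f ?c \<le> (1 - v) * f x + v * f y - \<alpha> / 2 * ((1 - v) * v) * (norm (x - y))\<^sup>2"
      using sc x y v unfolding strongly_convex_on_def by simp
    ultimately have "v * (f x - f y) \<le> v * (g \<bullet> (x - y) - (1 - v) * (\<alpha> / 2 * (norm (x - y))\<^sup>2))"
      by (simp add: algebra_simps inner_diff_right)
    then show ?thesis using v by simp
  qed
  have "((\<lambda>v. g \<bullet> (x - y) - (1 - v) * (\<alpha> / 2 * (norm (x - y))\<^sup>2)) \<longlongrightarrow>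
      g \<bullet> (x - y) - (1 - 0) * (\<alpha> / 2 * (norm (x - y))\<^sup>2)) (at_right 0)"
    by (intro tendsto_intros)
  moreover have "eventually (\<lambda>v. f x - f y \<le> g \<bullet> (x - y) - (1 - v) * (\<alpha> / 2 * (norm (x - y))\<^sup>2)) (at_right 0)"
  proof (rule eventually_at_rightI[of 0 1])
    show "f x - f y \<le> g \<bullet> (x - y) - (1 - v) * (\<alpha> / 2 * (norm (x - y))\<^sup>2)" if "v \<in> {0<..<1}" for v
      using that by (intro scaled) auto
  qed simp
  ultimately show ?thesis
    using tendsto_lowerbound[of _ _ "at_right (0::real)" "f x - f y"] by simp
qed

text \<open>The unconstrained minimizer of the objective of a local step, with current point \<open>x\<close>, subgradient
  \<open>G\<close>, consensus point \<open>v\<close>, multiplier \<open>l\<close> and noise \<open>\<xi>\<close>.\<close>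

definition step_centre :: "real \<Rightarrow> real \<Rightarrow> 'a::real_vector \<Rightarrow> 'a \<Rightarrow> 'a \<Rightarrow> 'a \<Rightarrow> 'a \<Rightarrow> 'a" where
  "step_centre \<eta> \<rho> x G v l \<xi> =
     (1 / (1 / \<eta> + \<rho>)) *\<^sub>R ((1 / \<eta>) *\<^sub>R x + \<rho> *\<^sub>R v + l - \<xi> - G)"

text \<open>The objective is a multiple of the squared distance to its unconstrained minimizer, up to a constant.
  The projection serves twice: its variational inequality is the optimality condition of the step,
  and its continuity makes the iterates measurable.\<close>

lemma local_step_is_projection:
  fixes x y v l \<xi> G :: "'a::euclidean_space"
  assumes min: "is_arg_min (\<lambda>u. G \<bullet> u + 1 / (2 * \<eta>) * (norm (u - x))\<^sup>2
      + \<rho> / 2 * (norm (v - u + (1 / \<rho>) *\<^sub>R (l - \<xi>)))\<^sup>2) (\<lambda>u. u \<in> S) y"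
    and S: "closed S" "convex S" and pos: "0 < \<eta>" "0 < \<rho>"
  shows "y = closest_point S (step_centre \<eta> \<rho> x G v l \<xi>)"
proof -
  define \<kappa> where "\<kappa> = 1 / \<eta> + \<rho>"
  define c where "c = step_centre \<eta> \<rho> x G v l \<xi>"
  define q where "q = (1 / \<rho>) *\<^sub>R (l - \<xi>)"
  define J where "J u = G \<bullet> u + 1 / (2 * \<eta>) * (norm (u - x))\<^sup>2 + \<rho> / 2 * (norm (v - u + q))\<^sup>2" for u
  have \<kappa>: "\<kappa> > 0" using pos by (simp add: \<kappa>_def add_pos_pos)
  have q: "l - \<xi> = \<rho> *\<^sub>R q" using pos by (simp add: q_def)
  have G: "G = (1 / \<eta>) *\<^sub>R x + \<rho> *\<^sub>R v + \<rho> *\<^sub>R q - \<kappa> *\<^sub>R c"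
  proof -
    have "\<kappa> *\<^sub>R c = (1 / \<eta>) *\<^sub>R x + \<rho> *\<^sub>R v + l - \<xi> - G"
      using \<kappa> unfolding c_def step_centre_def \<kappa>_def[symmetric] by simp
    then show ?thesis using q by (simp add: algebra_simps)
  qed
  have J: "J u - J y = \<kappa> / 2 * ((norm (c - u))\<^sup>2 - (norm (c - y))\<^sup>2)" for u
    unfolding J_def G \<kappa>_def power2_norm_eq_inner using pos
    by (simp add: inner_simps inner_commute algebra_simps add_divide_distrib diff_divide_distrib)
  have "y \<in> S" using min by (simp add: is_arg_min_def)
  moreover have "dist c y \<le> dist c u" if u: "u \<in> S" for u
  proof -
    have "J y \<le> J u" using min u unfolding is_arg_min_def J_def q_def by (auto simp: not_less)
    then have "0 \<le> \<kappa> / 2 * ((norm (c - u))\<^sup>2 - (norm (c - y))\<^sup>2)" using J[of u] by simp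
    then have "(norm (c - y))\<^sup>2 \<le> (norm (c - u))\<^sup>2" using \<kappa> by (simp add: zero_le_mult_iff)
    then show ?thesis by (simp add: dist_norm)
  qed
  ultimately show ?thesis unfolding c_def[symmetric] using S closest_point_unique by blast
qed

text \<open>Decompose \<open>G \<bullet> (x - u) = (G + \<xi>) \<bullet> (x - y) + (G + \<xi>) \<bullet> (y - u) - \<xi> \<bullet> (x - u)\<close>. Young's inequality
  bounds the first product, and the term \<open>(norm (x - y))\<^sup>2\<close> that it produces is cancelled by the
  three-point identity in the optimality condition, which bounds the second product. The third one
  keeps the noise paired with a vector known before the draw, hence has mean zero.\<close>

lemma local_step_inequality:
  fixes x y v l \<xi> G u :: "'a::euclidean_space"
  assumes min: "is_arg_min (\<lambda>u. G \<bullet> u + 1 / (2 * \<eta>) * (norm (u - x))\<^sup>2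
      + \<rho> / 2 * (norm (v - u + (1 / \<rho>) *\<^sub>R (l - \<xi>)))\<^sup>2) (\<lambda>u. u \<in> S) y"
    and S: "closed S" "convex S" and pos: "0 < \<eta>" "0 < \<rho>" and u: "u \<in> S"
    and G: "is_subgradient S f x G" and sc: "strongly_convex_on \<alpha> S f"
  shows "f x - f u \<le> \<eta> / 2 * (norm (G + \<xi>))\<^sup>2 - \<xi> \<bullet> (x - u)
      + 1 / (2 * \<eta>) * ((norm (x - u))\<^sup>2 - (norm (y - u))\<^sup>2) - \<alpha> / 2 * (norm (x - u))\<^sup>2
      + (l + \<rho> *\<^sub>R (v - y)) \<bullet> (y - u)"
proof -
  define \<kappa> where "\<kappa> = 1 / \<eta> + \<rho>"
  define c where "c = step_centre \<eta> \<rho> x G v l \<xi>"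
  have \<kappa>: "\<kappa> > 0" using pos by (simp add: \<kappa>_def add_pos_pos)
  have "(c - y) \<bullet> (u - y) \<le> 0"
    using closest_point_dot[OF S(2,1) u] local_step_is_projection[OF min S pos] by (simp add: c_def)
  then have "\<kappa> * ((c - y) \<bullet> (u - y)) \<le> 0" using \<kappa> by (simp add: mult_nonneg_nonpos)
  then have "(\<kappa> *\<^sub>R c - \<kappa> *\<^sub>R y) \<bullet> (u - y) \<le> 0"
    by (metis inner_scaleR_left scaleR_diff_right)
  also have c: "\<kappa> *\<^sub>R c = (1 / \<eta>) *\<^sub>R x + \<rho> *\<^sub>R v + l - \<xi> - G"
    using \<kappa> unfolding c_def step_centre_def \<kappa>_def[symmetric] by simp
  finally have opt: "(G + \<xi>) \<bullet> (y - u) \<le> (l + \<rho> *\<^sub>R (v - y)) \<bullet> (y - u) + 1 / \<eta> * ((x - y) \<bullet> (y - u))"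
    unfolding \<kappa>_def by (simp add: inner_simps inner_commute algebra_simps)
  have three: "1 / \<eta> * ((x - y) \<bullet> (y - u))
      = 1 / (2 * \<eta>) * ((norm (x - u))\<^sup>2 - (norm (y - u))\<^sup>2 - (norm (x - y))\<^sup>2)"
  proof -
    have "(norm (x - u))\<^sup>2 - (norm (y - u))\<^sup>2 - (norm (x - y))\<^sup>2 = 2 * ((x - y) \<bullet> (y - u))"
      unfolding power2_norm_eq_inner by (simp add: inner_simps inner_commute)
    then show ?thesis by simp
  qed
  have young: "a \<bullet> b \<le> \<eta> / 2 * (norm a)\<^sup>2 + 1 / (2 * \<eta>) * (norm b)\<^sup>2" for a b :: 'a
  proof -
    have "0 \<le> 1 / (2 * \<eta>) * (norm (\<eta> *\<^sub>R a - b))\<^sup>2" using pos by simp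
    also have "(norm (\<eta> *\<^sub>R a - b))\<^sup>2 = \<eta>\<^sup>2 * (norm a)\<^sup>2 + (norm b)\<^sup>2 - 2 * \<eta> * (a \<bullet> b)"
      unfolding power2_norm_eq_inner by (simp add: inner_simps inner_commute algebra_simps power2_eq_square)
    finally show ?thesis using pos by (simp add: field_simps power2_eq_square)
  qed
  have "f x - f u \<le> G \<bullet> (x - u) - \<alpha> / 2 * (norm (x - u))\<^sup>2"
    by (rule strong_subgradient_inequality[OF sc G u])
  also have "G \<bullet> (x - u) = (G + \<xi>) \<bullet> (x - y) + (G + \<xi>) \<bullet> (y - u) - \<xi> \<bullet> (x - u)"
    by (simp add: inner_simps)
  finally show ?thesis using opt three young[of "G + \<xi>" "x - y"] by (simp add: algebra_simps)
qed

section \<open>One consensus round\<close>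

text \<open>The summand is a concave quadratic function of \<open>x e\<close>, so its average is at most its value at the mean
  \<open>m\<close>, and a single multiplier update with \<open>m\<close> remains. Orthogonality is the optimality of the
  consensus point \<open>a\<close>; it trades \<open>lam' \<bullet> (a - u)\<close> for \<open>\<rho> * ((zt - m) \<bullet> (a - u))\<close>. After the two
  differences of squares, the slack is \<open>\<rho> / 2\<close> times the squared norm of \<open>(a - m) - (zt - m)\<close>.\<close>

lemma consensus_round_inequality:
  fixes lam \<mu> a zt u m lam' :: "'a::real_inner" and x :: "nat \<Rightarrow> 'a"
  assumes \<rho>: "\<rho> > 0" and E: "E \<ge> 1"
    and m: "m = (1 / real E) *\<^sub>R (\<Sum>e = 1..E. x e)" and lam': "lam' = lam + \<rho> *\<^sub>R (a - m)"
    and orth: "(lam + \<rho> *\<^sub>R (a - zt)) \<bullet> (a - u) = 0"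
  shows "(\<Sum>e = 1..E. (lam + \<rho> *\<^sub>R (a - x e)) \<bullet> (x e - u)) / real E + \<mu> \<bullet> (a - m)
    \<le> 1 / (2 * \<rho>) * ((norm (\<mu> - lam))\<^sup>2 - (norm (\<mu> - lam'))\<^sup>2)
      + \<rho> / 2 * ((norm (zt - u))\<^sup>2 - (norm (m - u))\<^sup>2)"
proof -
  have sum_x: "(\<Sum>e\<in>{1..E}. x e - m) = 0"
    using E by (simp add: sum_subtractf m sum_constant_scaleR del: sum_constant)
  have "(lam + \<rho> *\<^sub>R (a - x e)) \<bullet> (x e - u) \<le> lam' \<bullet> (m - u) + (lam' - \<rho> *\<^sub>R (m - u)) \<bullet> (x e - m)" for e
  proof -
    have "lam' \<bullet> (m - u) + (lam' - \<rho> *\<^sub>R (m - u)) \<bullet> (x e - m)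
        - (lam + \<rho> *\<^sub>R (a - x e)) \<bullet> (x e - u) = \<rho> * (norm (x e - m))\<^sup>2"
      unfolding lam' power2_norm_eq_inner by (simp add: inner_simps inner_commute algebra_simps)
    then show ?thesis using \<rho> by (smt (verit) mult_nonneg_nonneg zero_le_power2)
  qed
  then have "(\<Sum>e = 1..E. (lam + \<rho> *\<^sub>R (a - x e)) \<bullet> (x e - u))
      \<le> (\<Sum>e = 1..E. lam' \<bullet> (m - u) + (lam' - \<rho> *\<^sub>R (m - u)) \<bullet> (x e - m))"
    by (rule sum_mono)
  also have "\<dots> = real E * (lam' \<bullet> (m - u))"
    using sum_x by (simp add: sum.distrib flip: inner_sum_right)
  finally have avg: "(\<Sum>e = 1..E. (lam + \<rho> *\<^sub>R (a - x e)) \<bullet> (x e - u)) / real E \<le> lam' \<bullet> (m - u)"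
    using E by (simp add: field_simps)
  define d where "d = a - m"
  have lam: "lam = lam' - \<rho> *\<^sub>R d" by (simp add: lam' d_def)
  have "lam' \<bullet> (d + (m - u)) = \<rho> * ((zt - m) \<bullet> (d + (m - u)))"
    using orth unfolding lam d_def by (simp add: inner_simps inner_commute algebra_simps)
  moreover have "(norm (\<mu> - lam))\<^sup>2 - (norm (\<mu> - lam'))\<^sup>2 = \<rho>\<^sup>2 * (norm d)\<^sup>2 + 2 * \<rho> * ((\<mu> - lam') \<bullet> d)"
    unfolding lam power2_norm_eq_inner by (simp add: inner_simps inner_commute algebra_simps power2_eq_square)
  then have "1 / (2 * \<rho>) * ((norm (\<mu> - lam))\<^sup>2 - (norm (\<mu> - lam'))\<^sup>2) = \<rho> / 2 * (norm d)\<^sup>2 + (\<mu> - lam') \<bullet> d"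
    using \<rho> by (simp add: field_simps power2_eq_square)
  moreover have "(norm (zt - u))\<^sup>2 - (norm (m - u))\<^sup>2 = (norm (zt - m))\<^sup>2 + 2 * ((zt - m) \<bullet> (m - u))"
    unfolding power2_norm_eq_inner by (simp add: inner_simps inner_commute algebra_simps)
  then have "\<rho> / 2 * ((norm (zt - u))\<^sup>2 - (norm (m - u))\<^sup>2)
      = \<rho> / 2 * (norm (zt - m))\<^sup>2 + \<rho> * ((zt - m) \<bullet> (m - u))"
    by (simp add: distrib_left)
  moreover have "0 \<le> \<rho> / 2 * (norm (d - (zt - m)))\<^sup>2" using \<rho> by simp
  then have "0 \<le> \<rho> / 2 * ((norm d)\<^sup>2 + (norm (zt - m))\<^sup>2) - \<rho> * ((zt - m) \<bullet> d)"
    unfolding power2_norm_eq_inner by (simp add: inner_simps inner_commute algebra_simps)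
  moreover have "lam' \<bullet> (m - u) = lam' \<bullet> (d + (m - u)) - lam' \<bullet> d"
    "(zt - m) \<bullet> (d + (m - u)) = (zt - m) \<bullet> d + (zt - m) \<bullet> (m - u)"
    "(\<mu> - lam') \<bullet> d = \<mu> \<bullet> d - lam' \<bullet> d"
    by (simp_all add: inner_simps)
  ultimately have "lam' \<bullet> (m - u) + \<mu> \<bullet> d \<le> 1 / (2 * \<rho>) * ((norm (\<mu> - lam))\<^sup>2 - (norm (\<mu> - lam'))\<^sup>2)
      + \<rho> / 2 * ((norm (zt - u))\<^sup>2 - (norm (m - u))\<^sup>2)"
    by (simp add: distrib_left add_divide_distrib)
  then show ?thesis using avg by (simp add: d_def)
qed

section \<open>Weighted telescoping sums\<close>

text \<open>Summation by parts. The stronger bound with \<open>- b (T + 1)\<close> is what makes the induction work.\<close>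

lemma weighted_telescope_le:
  fixes k b :: "nat \<Rightarrow> real"
  assumes "T \<ge> 1" "0 \<le> k 1" "\<And>t. 1 \<le> t \<Longrightarrow> t < T \<Longrightarrow> k t \<le> k (t + 1)"
    and "\<And>t. 1 \<le> t \<Longrightarrow> t \<le> T \<Longrightarrow> b t \<le> B"
  shows "(\<Sum>t = 1..T. k t * (b t - b (t + 1))) \<le> k T * (B - b (T + 1))"
  using assms
proof (induction T rule: dec_induct)
  case base
  then show ?case by (auto intro!: mult_left_mono)
next
  case (step n)
  have "(\<Sum>t = 1..Suc n. k t * (b t - b (t + 1)))
      \<le> k n * (B - b (n + 1)) + k (Suc n) * (b (Suc n) - b (Suc n + 1))"
    using step by simp
  moreover have "k n * (B - b (n + 1)) \<le> k (Suc n) * (B - b (n + 1))"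
    using step by (intro mult_right_mono) auto
  ultimately show ?case by (simp add: algebra_simps)
qed

text \<open>The weights arise from \<open>t (t + 2) = (t + 1)\<^sup>2 - 1\<close>: the step size \<open>2 / (\<alpha> (t + 2))\<close> and strong
  convexity leave, up to a common factor, \<open>t\<^sup>2\<close> at the start of round \<open>t\<close> and \<open>(t + 1)\<^sup>2 - 1\<close> at its end,
  so each round leaves over just one \<open>a t\<close>.\<close>

lemma quadratic_weights_telescope_le:
  fixes a :: "nat \<Rightarrow> real"
  assumes "\<And>t. 1 \<le> t \<Longrightarrow> t \<le> T \<Longrightarrow> a t \<le> B" and "\<And>t. 0 \<le> a t"
  shows "(\<Sum>t = 1..T. (real t)\<^sup>2 * a t - ((real t + 1)\<^sup>2 - 1) * a (t + 1)) \<le> real T * B"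
proof -
  have "(\<Sum>t = 1..T. (real t)\<^sup>2 * a t - ((real t + 1)\<^sup>2 - 1) * a (t + 1))
      \<le> real T * B - ((real T + 1)\<^sup>2 - 1) * a (T + 1)"
    using assms(1)
  proof (induction T)
    case (Suc n)
    have "a (Suc n) \<le> B" using Suc.prems by simp
    moreover have "(\<Sum>t = 1..n. (real t)\<^sup>2 * a t - ((real t + 1)\<^sup>2 - 1) * a (t + 1))
      \<le> real n * B - ((real n + 1)\<^sup>2 - 1) * a (n + 1)" using Suc by simp
    ultimately show ?case by (simp add: algebra_simps power2_eq_square)
  qed simp
  moreover have "0 \<le> ((real T + 1)\<^sup>2 - 1) * a (T + 1)"
    using assms(2) by (intro mult_nonneg_nonneg) (auto simp: power2_eq_square algebra_simps)
  ultimately show ?thesis by linarith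
qed

section \<open>Stacked vectors\<close>

lemma norm_stacked_square: "(norm x)\<^sup>2 = (\<Sum>p\<in>UNIV. (norm (x $ p))\<^sup>2)"
  for x :: "('a::real_inner)^'p::finite"
  by (simp add: power2_norm_eq_inner inner_vec_def)

lemma convex_feasible_blocks:
  assumes "\<And>p. convex (W p)"
  shows "convex (feasible_blocks W)"
  using assms by (auto simp: feasible_blocks_def convex_def)

lemma convex_on_total_cost:
  fixes W :: "'p::finite \<Rightarrow> (real^'n) set"
  assumes f: "\<And>p. convex_on (W p) (f p)"
  shows "convex_on (feasible_blocks W) (total_cost f)"
proof (rule convex_onI)
  show "convex (feasible_blocks W)"
    using f by (intro convex_feasible_blocks) (auto intro: convex_on_imp_convex)
  fix t :: real and x y :: "(real^'n)^'p"
  assume t: "0 < t" "t < 1" and xy: "x \<in> feasible_blocks W" "y \<in> feasible_blocks W"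
  have "f p (((1 - t) *\<^sub>R x + t *\<^sub>R y) $ p) \<le> (1 - t) * f p (x $ p) + t * f p (y $ p)" for p
    using convex_onD[OF f, of t "x $ p" p "y $ p"] t xy by (simp add: feasible_blocks_def)
  then show "total_cost f ((1 - t) *\<^sub>R x + t *\<^sub>R y) \<le> (1 - t) * total_cost f x + t * total_cost f y"
    unfolding total_cost_def sum_distrib_left sum.distrib[symmetric] by (intro sum_mono)
qed

lemma stack_weighted_sum: "stack (\<Sum>t\<in>I. c t *\<^sub>R v t) = (\<Sum>t\<in>I. c t *\<^sub>R stack (v t))"
  by (simp add: stack_def vec_eq_iff sum_component)

lemma inner_stack: "x \<bullet> stack v = (\<Sum>p\<in>UNIV. x $ p) \<bullet> v"
  by (simp add: stack_def inner_vec_def[of x] inner_sum_left)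

lemma averaging_weights_sum:
  assumes "T \<ge> 1"
  shows "(\<Sum>t = 1..T. 2 / (real T * (real T + 1)) * real t) = 1"
proof -
  have "(\<Sum>t = 1..T. real t) = real T * (real T + 1) / 2"
    by (induction T) (auto simp: field_simps)
  then have "2 / (real T * (real T + 1)) * (\<Sum>t = 1..T. real t) = 1" using assms by simp
  then show ?thesis by (simp only: sum_distrib_left)
qed

section \<open>A single realization of the algorithm\<close>

text \<open>The part of the bound on one local step that involves the noise. It does not depend on the
  auxiliary multiplier that measures the consensus violation, which may therefore be chosen path by
  path without disturbing the expectation.\<close>

definition noise_cost ::
  "('p::finite \<Rightarrow> real^'n \<Rightarrow> real^'n) \<Rightarrow> (nat \<Rightarrow> real) \<Rightarrow> (nat \<Rightarrow> nat \<Rightarrow> 'p \<Rightarrow> real^'n) \<Rightarrow>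
   (nat \<Rightarrow> nat \<Rightarrow> (real^'n)^'p) \<Rightarrow> (real^'n)^'p \<Rightarrow> nat \<Rightarrow> nat \<Rightarrow> real" where
  "noise_cost g \<eta> \<xi> z u t e = (\<Sum>p\<in>UNIV. \<eta> t / 2 * (norm (g p (z t e $ p) + \<xi> t e p))\<^sup>2
     - \<xi> t e p \<bullet> (z t e $ p - u $ p))"

locale admm_setting =
  fixes W :: "'p::finite \<Rightarrow> (real^'n) set" and f :: "'p \<Rightarrow> real^'n \<Rightarrow> real"
    and g :: "'p \<Rightarrow> real^'n \<Rightarrow> real^'n" and \<rho> \<eta> :: "nat \<Rightarrow> real" and T E :: nat and \<alpha> :: real
    and lam1 z1 :: "(real^'n)^'p"
  assumes sizes: "T \<ge> 1" "E \<ge> 1"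
    and W_compact: "\<And>p. compact (W p)" and W_convex: "\<And>p. convex (W p)"
    and subgradient: "\<And>p u. u \<in> W p \<Longrightarrow> is_subgradient (W p) (f p) u (g p u)"
    and alpha_pos: "\<alpha> > 0" and strongly_convex: "\<And>p. strongly_convex_on \<alpha> (W p) (f p)"
    and f_convex: "\<And>p. convex_on (W p) (f p)"
    and rho_1: "0 < \<rho> 1" and rho_mono: "\<And>t. 1 \<le> t \<Longrightarrow> t < T \<Longrightarrow> \<rho> t \<le> \<rho> (t + 1)"
    and eta: "\<And>t. 1 \<le> t \<Longrightarrow> t \<le> T \<Longrightarrow> \<eta> t = 2 / (\<alpha> * (real t + 2))"
    and z1: "z1 \<in> feasible_blocks W"
begin

lemma W_closed: "closed (W p)"
  using W_compact by (rule compact_imp_closed)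

lemma rho_ge_first:
  assumes "1 \<le> t" "t \<le> T"
  shows "\<rho> 1 \<le> \<rho> t"
  using assms
proof (induction t rule: dec_induct)
  case (step n)
  then show ?case using rho_mono[of n] by simp
qed simp

lemma rho_pos: "1 \<le> t \<Longrightarrow> t \<le> T \<Longrightarrow> 0 < \<rho> t"
  using rho_ge_first rho_1 by (meson less_le_trans)

lemma eta_pos: "1 \<le> t \<Longrightarrow> t \<le> T \<Longrightarrow> 0 < \<eta> t"
  using eta alpha_pos by simp

end

locale admm_run = admm_setting W f g \<rho> \<eta> T E \<alpha> lam1 z1
  for W :: "'p::finite \<Rightarrow> (real^'n) set" and f g \<rho> \<eta> T E \<alpha> lam1 z1 +
  fixes \<xi> :: "nat \<Rightarrow> nat \<Rightarrow> 'p \<Rightarrow> real^'n" and w :: "nat \<Rightarrow> real^'n"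
    and z :: "nat \<Rightarrow> nat \<Rightarrow> (real^'n)^'p" and zb lam :: "nat \<Rightarrow> (real^'n)^'p"
  assumes run: "dp_linearized_admm W g \<rho> \<eta> T E lam1 z1 \<xi> w z zb lam"
begin

lemma start: "lam 1 = lam1" "zb 1 = z1" "z 0 (E + 1) = z1"
  using run by (auto simp: dp_linearized_admm_def)

lemma w_step:
  "t \<in> {1..T} \<Longrightarrow> w (t + 1) = (1 / real CARD('p)) *\<^sub>R (\<Sum>p\<in>UNIV. zb t $ p - (1 / \<rho> t) *\<^sub>R lam t $ p)"
  using run by (auto simp: dp_linearized_admm_def)

lemma z_first: "t \<in> {1..T} \<Longrightarrow> z t 1 = z (t - 1) (E + 1)"
  using run by (auto simp: dp_linearized_admm_def)

lemma local_step:
  "t \<in> {1..T} \<Longrightarrow> e \<in> {1..E} \<Longrightarrow> is_arg_min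
     (\<lambda>u. g p (z t e $ p) \<bullet> u + 1 / (2 * \<eta> t) * (norm (u - z t e $ p))\<^sup>2
       + \<rho> t / 2 * (norm (w (t + 1) - u + (1 / \<rho> t) *\<^sub>R (lam t $ p - \<xi> t e p)))\<^sup>2)
     (\<lambda>u. u \<in> W p) (z t (e + 1) $ p)"
  using run unfolding dp_linearized_admm_def by blast

lemma zb_step: "t \<in> {1..T} \<Longrightarrow> zb (t + 1) = (1 / real E) *\<^sub>R (\<Sum>e = 1..E. z t (e + 1))"
  using run by (auto simp: dp_linearized_admm_def)

lemma lam_step: "t \<in> {1..T} \<Longrightarrow> lam (t + 1) = lam t + \<rho> t *\<^sub>R (stack (w (t + 1)) - zb (t + 1))"
  using run by (auto simp: dp_linearized_admm_def)

lemma z_Suc_feasible: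
  assumes "t \<in> {1..T}" "e \<in> {1..E}"
  shows "z t (e + 1) \<in> feasible_blocks W"
  using local_step[OF assms] by (simp add: feasible_blocks_def is_arg_min_def)

lemma z_last_feasible:
  assumes "t \<le> T"
  shows "z t (E + 1) \<in> feasible_blocks W"
proof (cases "t = 0")
  case True
  then show ?thesis using start z1 by simp
next
  case False
  then show ?thesis using assms sizes by (intro z_Suc_feasible) auto
qed

lemma z_feasible:
  assumes "t \<in> {1..T}" "e \<in> {1..E + 1}"
  shows "z t e \<in> feasible_blocks W"
proof (cases "e = 1")
  case True
  moreover have "t - 1 \<le> T" using assms by auto
  ultimately show ?thesis using z_last_feasible[of "t - 1"] z_first[of t] assms by simp
next
  case False
  then have "e - 1 \<in> {1..E}" "e - 1 + 1 = e" using assms by auto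
  then show ?thesis using z_Suc_feasible[OF assms(1), of "e - 1"] by simp
qed

lemma zb_feasible:
  assumes "t \<in> {1..T + 1}"
  shows "zb t \<in> feasible_blocks W"
proof (cases "t = 1")
  case True
  then show ?thesis using start z1 by simp
next
  case False
  then have t: "t - 1 \<in> {1..T}" using assms by auto
  have "(\<Sum>e = 1..E. (1 / real E) *\<^sub>R z (t - 1) (e + 1)) \<in> feasible_blocks W"
    using sizes z_Suc_feasible[OF t]
    by (intro convex_sum convex_feasible_blocks W_convex) auto
  then show ?thesis using zb_step[OF t] False assms by (simp add: scaleR_sum_right)
qed

lemma round_mean_feasible:
  assumes "t \<in> {1..T}"
  shows "(1 / real E) *\<^sub>R (\<Sum>e = 1..E. z t e) \<in> feasible_blocks W"
  unfolding scaleR_sum_right using sizes z_feasible[OF assms]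
  by (intro convex_sum convex_feasible_blocks W_convex) auto

lemma z_avg_feasible: "z_avg T E z \<in> feasible_blocks W"
proof -
  have "(\<Sum>t = 1..T. (2 / (real T * (real T + 1)) * real t) *\<^sub>R ((1 / real E) *\<^sub>R (\<Sum>e = 1..E. z t e)))
      \<in> feasible_blocks W"
    using sizes averaging_weights_sum[of T]
    by (intro convex_sum convex_feasible_blocks W_convex round_mean_feasible) auto
  then show ?thesis by (simp add: z_avg_def scaleR_sum_right)
qed

text \<open>The inequalities of the single agents add up, since norms and inner products of stacked vectors do.\<close>

lemma stacked_step_inequality:
  assumes te: "t \<in> {1..T}" "e \<in> {1..E}" and u: "u \<in> feasible_blocks W"
  shows "total_cost f (z t e) - total_cost f u \<le> noise_cost g \<eta> \<xi> z u t e
      + 1 / (2 * \<eta> t) * ((norm (z t e - u))\<^sup>2 - (norm (z t (e + 1) - u))\<^sup>2)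
      - \<alpha> / 2 * (norm (z t e - u))\<^sup>2
      + (lam t + \<rho> t *\<^sub>R (stack (w (t + 1)) - z t (e + 1))) \<bullet> (z t (e + 1) - u)"
proof -
  have block: "f p (z t e $ p) - f p (u $ p)
      \<le> \<eta> t / 2 * (norm (g p (z t e $ p) + \<xi> t e p))\<^sup>2 - \<xi> t e p \<bullet> (z t e $ p - u $ p)
      + 1 / (2 * \<eta> t) * ((norm (z t e $ p - u $ p))\<^sup>2 - (norm (z t (e + 1) $ p - u $ p))\<^sup>2)
      - \<alpha> / 2 * (norm (z t e $ p - u $ p))\<^sup>2
      + (lam t $ p + \<rho> t *\<^sub>R (w (t + 1) - z t (e + 1) $ p)) \<bullet> (z t (e + 1) $ p - u $ p)" for p
  proof (rule local_step_inequality[OF local_step[OF te] W_closed W_convex])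
    show "0 < \<eta> t" "0 < \<rho> t" using te eta_pos rho_pos by auto
    show "u $ p \<in> W p" using u by (simp add: feasible_blocks_def)
    have "z t e $ p \<in> W p" using z_feasible[of t e] te by (simp add: feasible_blocks_def)
    then show "is_subgradient (W p) (f p) (z t e $ p) (g p (z t e $ p))" by (rule subgradient)
  qed (rule strongly_convex)
  have "total_cost f (z t e) - total_cost f u = (\<Sum>p\<in>UNIV. f p (z t e $ p) - f p (u $ p))"
    by (simp add: total_cost_def sum_subtractf)
  also note sum_mono[OF block]
  finally show ?thesis
    unfolding noise_cost_def norm_stacked_square inner_vec_def stack_def
    by (simp add: sum.distrib sum_subtractf sum_distrib_left right_diff_distrib)
qed

text \<open>The consensus point is the unconstrained minimizer of the augmented Lagrangian in \<open>w\<close>, and this is its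
  first-order condition.\<close>

lemma multiplier_orthogonal:
  assumes t: "t \<in> {1..T}"
  shows "(lam t + \<rho> t *\<^sub>R (stack (w (t + 1)) - zb t)) \<bullet> stack v = 0"
proof -
  have "\<rho> t \<noteq> 0" using rho_pos t by (metis atLeastAtMost_iff less_irrefl)
  moreover have "real CARD('p) *\<^sub>R w (t + 1) = (\<Sum>p\<in>UNIV. zb t $ p) - (1 / \<rho> t) *\<^sub>R (\<Sum>p\<in>UNIV. lam t $ p)"
    using w_step[OF t] by (simp add: sum_subtractf scaleR_sum_right)
  ultimately have "\<rho> t *\<^sub>R (real CARD('p) *\<^sub>R w (t + 1) - (\<Sum>p\<in>UNIV. zb t $ p)) = - (\<Sum>p\<in>UNIV. lam t $ p)"
    by simp
  moreover have "(\<Sum>p\<in>UNIV. (lam t + \<rho> t *\<^sub>R (stack (w (t + 1)) - zb t)) $ p)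
      = (\<Sum>p\<in>UNIV. lam t $ p) + \<rho> t *\<^sub>R (real CARD('p) *\<^sub>R w (t + 1) - (\<Sum>p\<in>UNIV. zb t $ p))"
    by (simp add: sum.distrib sum_subtractf stack_def sum_constant_scaleR
        flip: scaleR_sum_right del: sum_constant)
  ultimately have "(\<Sum>p\<in>UNIV. (lam t + \<rho> t *\<^sub>R (stack (w (t + 1)) - zb t)) $ p) = 0" by simp
  then show ?thesis by (simp add: inner_stack)
qed

text \<open>The distances to \<open>u\<close> telescope over the local steps. Of the strong convexity terms only the one of the
  first step is kept, the only one that can be combined with the telescoped distances.\<close>

lemma round_inequality:
  assumes t: "t \<in> {1..T}" and u: "u \<in> feasible_blocks W" "u = stack v"
  shows "(\<Sum>e = 1..E. total_cost f (z t e) - total_cost f u) / real E + \<mu> \<bullet> (stack (w (t + 1)) - zb (t + 1))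
    \<le> (\<Sum>e = 1..E. noise_cost g \<eta> \<xi> z u t e) / real E
      + (1 / (2 * \<eta> t) * ((norm (z t 1 - u))\<^sup>2 - (norm (z t (E + 1) - u))\<^sup>2) - \<alpha> / 2 * (norm (z t 1 - u))\<^sup>2) / real E
      + 1 / (2 * \<rho> t) * ((norm (\<mu> - lam t))\<^sup>2 - (norm (\<mu> - lam (t + 1)))\<^sup>2)
      + \<rho> t / 2 * ((norm (zb t - u))\<^sup>2 - (norm (zb (t + 1) - u))\<^sup>2)"
proof -
  let ?a = "stack (w (t + 1)) :: (real^'n)^'p"
  let ?d = "\<lambda>e. (norm (z t e - u))\<^sup>2"
  let ?C = "\<Sum>e = 1..E. (lam t + \<rho> t *\<^sub>R (?a - z t (e + 1))) \<bullet> (z t (e + 1) - u)"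
  have split: "(\<Sum>e\<in>I. n e + b * p e - k * q e + r e) = sum n I + b * sum p I - k * sum q I + sum r I"
    for n p q r :: "nat \<Rightarrow> real" and b k I
    by (simp add: sum.distrib sum_subtractf sum_distrib_left)
  have "(\<Sum>e = 1..E. total_cost f (z t e) - total_cost f u)
      \<le> (\<Sum>e = 1..E. noise_cost g \<eta> \<xi> z u t e + 1 / (2 * \<eta> t) * (?d e - ?d (e + 1)) - \<alpha> / 2 * ?d e
        + (lam t + \<rho> t *\<^sub>R (?a - z t (e + 1))) \<bullet> (z t (e + 1) - u))"
    using t u by (intro sum_mono stacked_step_inequality) auto
  also have "\<dots> = (\<Sum>e = 1..E. noise_cost g \<eta> \<xi> z u t e) + 1 / (2 * \<eta> t) * (\<Sum>e = 1..E. ?d e - ?d (e + 1))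
      - \<alpha> / 2 * (\<Sum>e = 1..E. ?d e) + ?C"
    by (rule split)
  also have "(\<Sum>e = 1..E. ?d e - ?d (e + 1)) = ?d 1 - ?d (E + 1)"
    by (induction E) auto
  finally have "(\<Sum>e = 1..E. total_cost f (z t e) - total_cost f u)
      \<le> (\<Sum>e = 1..E. noise_cost g \<eta> \<xi> z u t e) + 1 / (2 * \<eta> t) * (?d 1 - ?d (E + 1))
        - \<alpha> / 2 * (\<Sum>e = 1..E. ?d e) + ?C" .
  moreover have "\<alpha> / 2 * ?d 1 \<le> \<alpha> / 2 * (\<Sum>e = 1..E. ?d e)"
    using alpha_pos sizes by (intro mult_left_mono member_le_sum) auto
  ultimately have "(\<Sum>e = 1..E. total_cost f (z t e) - total_cost f u)
      \<le> (\<Sum>e = 1..E. noise_cost g \<eta> \<xi> z u t e) + (1 / (2 * \<eta> t) * (?d 1 - ?d (E + 1)) - \<alpha> / 2 * ?d 1) + ?C"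
    by linarith
  then have "(\<Sum>e = 1..E. total_cost f (z t e) - total_cost f u) / real E
      \<le> ((\<Sum>e = 1..E. noise_cost g \<eta> \<xi> z u t e) + (1 / (2 * \<eta> t) * (?d 1 - ?d (E + 1)) - \<alpha> / 2 * ?d 1) + ?C) / real E"
    by (rule divide_right_mono) simp
  moreover have "?C / real E + \<mu> \<bullet> (?a - zb (t + 1))
      \<le> 1 / (2 * \<rho> t) * ((norm (\<mu> - lam t))\<^sup>2 - (norm (\<mu> - lam (t + 1)))\<^sup>2)
        + \<rho> t / 2 * ((norm (zb t - u))\<^sup>2 - (norm (zb (t + 1) - u))\<^sup>2)"
  proof (rule consensus_round_inequality)
    show "0 < \<rho> t" "1 \<le> E" using t rho_pos sizes by auto
    show "zb (t + 1) = (1 / real E) *\<^sub>R (\<Sum>e = 1..E. z t (e + 1))" using t by (rule zb_step)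
    show "lam (t + 1) = lam t + \<rho> t *\<^sub>R (?a - zb (t + 1))" using t by (rule lam_step)
    have "?a - u = stack (w (t + 1) - v)" by (simp add: u stack_def vec_eq_iff)
    then show "(lam t + \<rho> t *\<^sub>R (?a - zb t)) \<bullet> (?a - u) = 0" by (simp only: multiplier_orthogonal[OF t])
  qed
  ultimately show ?thesis by (simp add: add_divide_distrib)
qed

text \<open>The consensus violation is the inner product of \<open>gap\<close> with a multiplier \<open>\<mu>\<close> of norm at most \<open>\<gamma>\<close> that
  points in its direction; Jensen's inequality reduces the rest to the weighted sum of the round
  inequalities. The averages in the conclusion run over the local iterates \<open>1..E\<close> and those of the
  algorithm over \<open>2..E+1\<close>; per round they differ by \<open>1 / E\<close> times the displacement of the local iterate, a
  drift that telescopes as well and contributes \<open>2 * D * \<gamma>\<close>.\<close>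

lemma ergodic_gap_bound:
  assumes u: "u \<in> feasible_blocks W" "u = stack v"
    and diam: "\<And>x y. x \<in> feasible_blocks W \<Longrightarrow> y \<in> feasible_blocks W \<Longrightarrow> norm (x - y) \<le> D"
    and gamma: "\<gamma> > 0" "\<And>t. 1 \<le> t \<Longrightarrow> t \<le> T \<Longrightarrow> norm (lam t) \<le> \<gamma>"
    and rho_max: "\<rho> T \<le> \<rho>max"
    and rho_growth: "\<And>t. 2 \<le> t \<Longrightarrow> t \<le> T \<Longrightarrow> \<rho> t \<le> real t / (real t - 1) * \<rho> (t - 1)"
  shows "total_cost f (z_avg T E z) - total_cost f u + \<gamma> * norm (stack (w_avg T w) - z_avg T E z)
    \<le> 1 / (real T + 1) * (2 * D * \<gamma> + D\<^sup>2 * \<rho>max + 4 * \<gamma>\<^sup>2 / \<rho> 1 + \<alpha> * D\<^sup>2 / (2 * real E))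
      + 2 / (real T * (real T + 1)) * (\<Sum>t = 1..T. real t * ((\<Sum>e = 1..E. noise_cost g \<eta> \<xi> z u t e) / real E))"
proof -
  define c where "c = 2 / (real T * (real T + 1))"
  define zm where "zm t = (1 / real E) *\<^sub>R (\<Sum>e = 1..E. z t e)" for t
  define a where "a t = (stack (w (t + 1)) :: (real^'n)^'p)" for t
  define gap where "gap = stack (w_avg T w) - z_avg T E z"
  define \<mu> where "\<mu> = \<gamma> *\<^sub>R sgn gap"
  \<comment> \<open>the initial point of the local loop of round \<open>t\<close>\<close>
  define y where "y t = z (t - 1) (E + 1)" for t
  have T: "real T \<ge> 1" and E: "real E \<ge> 1" using sizes by auto
  have D: "D \<ge> 0" using diam[OF u(1) u(1)] by simp
  have \<mu>_norm: "norm \<mu> \<le> \<gamma>" using gamma by (simp add: \<mu>_def norm_sgn)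
  have \<mu>_gap: "\<mu> \<bullet> gap = \<gamma> * norm gap"
    by (cases "gap = 0") (simp_all add: \<mu>_def sgn_div_norm dot_square_norm power2_eq_square)
  have weights: "(\<Sum>t = 1..T. c * real t) = 1"
    unfolding c_def using sizes by (intro averaging_weights_sum) simp
  have c: "c \<ge> 0" by (simp add: c_def)
  have z_avg: "z_avg T E z = (\<Sum>t = 1..T. (c * real t) *\<^sub>R zm t)"
    by (simp add: z_avg_def c_def zm_def scaleR_sum_right)
  have "stack (w_avg T w) = (\<Sum>t = 1..T. (c * real t) *\<^sub>R a t)"
    by (simp add: w_avg_def c_def[symmetric] scaleR_sum_right stack_weighted_sum a_def)
  then have gap: "gap = (\<Sum>t = 1..T. (c * real t) *\<^sub>R (a t - zm t))"
    by (simp add: gap_def z_avg scaleR_diff_right sum_subtractf)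
  note cost_convex = convex_on_total_cost[OF f_convex]
  have zm_feasible: "zm t \<in> feasible_blocks W" if "t \<in> {1..T}" for t
    unfolding zm_def by (rule round_mean_feasible[OF that])
  have zm_cost: "total_cost f (zm t) - total_cost f u \<le> (\<Sum>e = 1..E. total_cost f (z t e) - total_cost f u) / real E"
    if t: "t \<in> {1..T}" for t
  proof -
    have "total_cost f (\<Sum>e = 1..E. (1 / real E) *\<^sub>R z t e) \<le> (\<Sum>e = 1..E. 1 / real E * total_cost f (z t e))"
      using sizes z_feasible[OF t] by (intro convex_on_sum[OF _ _ cost_convex]) auto
    then show ?thesis using E by (simp add: zm_def scaleR_sum_right sum_subtractf sum_divide_distrib diff_divide_distrib)
  qed
  define R where "R t = (\<Sum>e = 1..E. total_cost f (z t e) - total_cost f u) / real E + \<mu> \<bullet> (a t - zm t)" for t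
  have "total_cost f (z_avg T E z) \<le> (\<Sum>t = 1..T. (c * real t) * total_cost f (zm t))"
    unfolding z_avg using sizes c weights zm_feasible by (intro convex_on_sum[OF _ _ cost_convex]) auto
  also have "\<dots> = (\<Sum>t = 1..T. (c * real t) * (total_cost f (zm t) - total_cost f u)) + total_cost f u"
    using weights by (simp add: right_diff_distrib sum_subtractf flip: sum_distrib_right)
  also have "(\<Sum>t = 1..T. (c * real t) * (total_cost f (zm t) - total_cost f u))
      \<le> (\<Sum>t = 1..T. (c * real t) * ((\<Sum>e = 1..E. total_cost f (z t e) - total_cost f u) / real E))"
    using c by (intro sum_mono mult_left_mono zm_cost) auto
  finally have "total_cost f (z_avg T E z) - total_cost f u + \<gamma> * norm gap
      \<le> (\<Sum>t = 1..T. (c * real t) * R t)"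
    unfolding \<mu>_gap[symmetric] R_def by (simp add: gap inner_sum_right distrib_left sum.distrib)
  also have "\<dots> = c * (\<Sum>t = 1..T. real t * R t)"
    by (simp add: sum_distrib_left mult.assoc)
  finally have main: "total_cost f (z_avg T E z) - total_cost f u + \<gamma> * norm gap
      \<le> c * (\<Sum>t = 1..T. real t * R t)" .

  \<comment> \<open>the telescoping quantities: distances of the local and of the averaged iterate, distance of the multiplier, drift\<close>
  define A where "A t = (norm (y t - u))\<^sup>2" for t
  define B where "B t = (norm (zb t - u))\<^sup>2" for t
  define L where "L t = (norm (\<mu> - lam t))\<^sup>2" for t
  define d where "d t = \<mu> \<bullet> (y (T + 1) - y t)" for t
  define N where "N t = (\<Sum>e = 1..E. noise_cost g \<eta> \<xi> z u t e) / real E" for t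
  have y_feasible: "y t \<in> feasible_blocks W" if "t \<in> {1..T + 1}" for t
    unfolding y_def using that by (intro z_last_feasible) auto
  have round: "real t * R t \<le> real t * N t
      + \<alpha> / (4 * real E) * ((real t)\<^sup>2 * A t - ((real t + 1)\<^sup>2 - 1) * A (t + 1))
      + (real t / (2 * \<rho> t)) * (L t - L (t + 1)) + (real t * \<rho> t / 2) * (B t - B (t + 1))
      + 1 / real E * (real t * (d t - d (t + 1)))" if t: "t \<in> {1..T}" for t
  proof -
    have y: "z t 1 = y t" "z t (E + 1) = y (t + 1)" using z_first[OF t] by (simp_all add: y_def)
    have "(\<Sum>e = 1..E. z t (e + 1)) = (\<Sum>e = 1..E. z t e) + (z t (E + 1) - z t 1)"
      by (induction E) auto
    then have "zm t = zb (t + 1) + (1 / real E) *\<^sub>R (y t - y (t + 1))"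
      unfolding zm_def zb_step[OF t] y by (simp flip: scaleR_add_right)
    then have "\<mu> \<bullet> (a t - zm t) = \<mu> \<bullet> (a t - zb (t + 1)) + 1 / real E * (d t - d (t + 1))"
      by (simp add: d_def inner_simps diff_divide_distrib)
    then have "R t \<le> N t + (1 / (2 * \<eta> t) * (A t - A (t + 1)) - \<alpha> / 2 * A t) / real E
        + 1 / (2 * \<rho> t) * (L t - L (t + 1)) + \<rho> t / 2 * (B t - B (t + 1)) + 1 / real E * (d t - d (t + 1))"
      using round_inequality[OF t u, of \<mu>]
      unfolding R_def N_def A_def B_def L_def a_def y by linarith
    then have "real t * R t \<le> real t * (N t + (1 / (2 * \<eta> t) * (A t - A (t + 1)) - \<alpha> / 2 * A t) / real E
        + 1 / (2 * \<rho> t) * (L t - L (t + 1)) + \<rho> t / 2 * (B t - B (t + 1)) + 1 / real E * (d t - d (t + 1)))"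
      by (rule mult_left_mono) simp
    also have "\<dots> = real t * N t + real t * ((1 / (2 * \<eta> t) * (A t - A (t + 1)) - \<alpha> / 2 * A t) / real E)
        + (real t / (2 * \<rho> t)) * (L t - L (t + 1)) + (real t * \<rho> t / 2) * (B t - B (t + 1))
        + 1 / real E * (real t * (d t - d (t + 1)))"
      by (simp add: distrib_left)
    also have "1 / (2 * \<eta> t) = \<alpha> * (real t + 2) / 4" using eta[of t] t by simp
    also have "real t * ((\<alpha> * (real t + 2) / 4 * (A t - A (t + 1)) - \<alpha> / 2 * A t) / real E)
        = \<alpha> / (4 * real E) * ((real t)\<^sup>2 * A t - ((real t + 1)\<^sup>2 - 1) * A (t + 1))"
      using E by (simp add: field_simps power2_eq_square)
    finally show ?thesis .
  qed
  have sumA: "(\<Sum>t = 1..T. (real t)\<^sup>2 * A t - ((real t + 1)\<^sup>2 - 1) * A (t + 1)) \<le> real T * D\<^sup>2"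
    unfolding A_def using D diam y_feasible u
    by (intro quadratic_weights_telescope_le power_mono) auto
  \<comment> \<open>the weights \<open>t * \<rho> t\<close> do not decrease because \<open>\<rho>\<close> does not\<close>
  have sumB: "(\<Sum>t = 1..T. (real t * \<rho> t / 2) * (B t - B (t + 1))) \<le> real T / 2 * (D\<^sup>2 * \<rho>max)"
  proof -
    have "(\<Sum>t = 1..T. (real t * \<rho> t / 2) * (B t - B (t + 1))) \<le> real T * \<rho> T / 2 * (D\<^sup>2 - B (T + 1))"
    proof (rule weighted_telescope_le)
      show "real t * \<rho> t / 2 \<le> real (t + 1) * \<rho> (t + 1) / 2" if "1 \<le> t" "t < T" for t
        using that rho_mono[of t] rho_pos[of t] by (intro divide_right_mono mult_mono) auto
      show "B t \<le> D\<^sup>2" if "1 \<le> t" "t \<le> T" for t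
        unfolding B_def using that diam zb_feasible[of t] u by (intro power_mono) auto
    qed (use sizes rho_1 in auto)
    also have "\<dots> \<le> real T * \<rho> T / 2 * D\<^sup>2"
      using rho_pos[of T] sizes by (intro mult_left_mono) (auto simp: B_def)
    also have "\<dots> = real T / 2 * D\<^sup>2 * \<rho> T" by simp
    also have "\<dots> \<le> real T / 2 * D\<^sup>2 * \<rho>max" using rho_max by (intro mult_left_mono) auto
    finally show ?thesis by simp
  qed
  \<comment> \<open>the weights \<open>t / \<rho> t\<close> do not decrease by the growth condition on \<open>\<rho>\<close>\<close>
  have sumL: "(\<Sum>t = 1..T. (real t / (2 * \<rho> t)) * (L t - L (t + 1))) \<le> real T / 2 * (4 * \<gamma>\<^sup>2 / \<rho> 1)"
  proof -
    have "(\<Sum>t = 1..T. (real t / (2 * \<rho> t)) * (L t - L (t + 1))) \<le> real T / (2 * \<rho> T) * ((2 * \<gamma>)\<^sup>2 - L (T + 1))"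
    proof (rule weighted_telescope_le)
      show "real t / (2 * \<rho> t) \<le> real (t + 1) / (2 * \<rho> (t + 1))" if "1 \<le> t" "t < T" for t
      proof -
        have "\<rho> (t + 1) \<le> (real t + 1) / real t * \<rho> t" using rho_growth[of "t + 1"] that by (simp add: add.commute)
        then have "real t * \<rho> (t + 1) \<le> (real t + 1) * \<rho> t" using that by (simp add: field_simps)
        then show ?thesis using that rho_pos[of t] rho_pos[of "t + 1"] by (simp add: field_simps)
      qed
      show "L t \<le> (2 * \<gamma>)\<^sup>2" if "1 \<le> t" "t \<le> T" for t
        unfolding L_def using norm_triangle_ineq4[of \<mu> "lam t"] \<mu>_norm gamma(2)[OF that]
        by (intro power_mono) auto
    qed (use sizes rho_1 in auto)
    also have "\<dots> \<le> real T / (2 * \<rho> T) * (2 * \<gamma>)\<^sup>2"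
      using rho_pos[of T] sizes by (intro mult_left_mono) (auto simp: L_def)
    also have "\<dots> \<le> real T / (2 * \<rho> 1) * (2 * \<gamma>)\<^sup>2"
      using rho_ge_first[of T] sizes rho_1 rho_pos[of T]
      by (intro mult_right_mono divide_left_mono) auto
    finally show ?thesis by (simp add: power_mult_distrib)
  qed
  have sumd: "1 / real E * (\<Sum>t = 1..T. real t * (d t - d (t + 1))) \<le> real T * (D * \<gamma>)"
  proof -
    have "(\<Sum>t = 1..T. real t * (d t - d (t + 1))) \<le> real T * (D * \<gamma> - d (T + 1))"
    proof (rule weighted_telescope_le)
      show "d t \<le> D * \<gamma>" if "1 \<le> t" "t \<le> T" for t
      proof -
        have "d t \<le> norm \<mu> * norm (y (T + 1) - y t)" unfolding d_def by (rule norm_cauchy_schwarz)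
        also have "\<dots> \<le> \<gamma> * D"
          using \<mu>_norm diam y_feasible that gamma by (intro mult_mono) auto
        finally show ?thesis by (simp add: mult.commute)
      qed
    qed (use sizes in auto)
    then have "1 / real E * (\<Sum>t = 1..T. real t * (d t - d (t + 1))) \<le> 1 / real E * (real T * (D * \<gamma>))"
      by (intro mult_left_mono) (auto simp: d_def)
    also have "\<dots> \<le> 1 * (real T * (D * \<gamma>))" using E D gamma by (intro mult_right_mono) auto
    finally show ?thesis by simp
  qed
  have "(\<Sum>t = 1..T. real t * R t) \<le> (\<Sum>t = 1..T. real t * N t
      + \<alpha> / (4 * real E) * ((real t)\<^sup>2 * A t - ((real t + 1)\<^sup>2 - 1) * A (t + 1))
      + (real t / (2 * \<rho> t)) * (L t - L (t + 1)) + (real t * \<rho> t / 2) * (B t - B (t + 1))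
      + 1 / real E * (real t * (d t - d (t + 1))))"
    by (rule sum_mono[OF round])
  also have "\<dots> = (\<Sum>t = 1..T. real t * N t)
      + \<alpha> / (4 * real E) * (\<Sum>t = 1..T. (real t)\<^sup>2 * A t - ((real t + 1)\<^sup>2 - 1) * A (t + 1))
      + (\<Sum>t = 1..T. (real t / (2 * \<rho> t)) * (L t - L (t + 1)))
      + (\<Sum>t = 1..T. (real t * \<rho> t / 2) * (B t - B (t + 1)))
      + 1 / real E * (\<Sum>t = 1..T. real t * (d t - d (t + 1)))"
    by (simp only: sum.distrib sum_distrib_left)
  also have "\<dots> \<le> (\<Sum>t = 1..T. real t * N t) + \<alpha> / (4 * real E) * (real T * D\<^sup>2)
      + real T / 2 * (4 * \<gamma>\<^sup>2 / \<rho> 1) + real T / 2 * (D\<^sup>2 * \<rho>max) + real T * (D * \<gamma>)"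
    using alpha_pos by (intro add_mono order_refl mult_left_mono sumA sumB sumL sumd) auto
  also have "\<dots> = (\<Sum>t = 1..T. real t * N t)
      + real T / 2 * (2 * D * \<gamma> + D\<^sup>2 * \<rho>max + 4 * \<gamma>\<^sup>2 / \<rho> 1 + \<alpha> * D\<^sup>2 / (2 * real E))"
    by (simp add: distrib_left)
  finally have "c * (\<Sum>t = 1..T. real t * R t) \<le> c * ((\<Sum>t = 1..T. real t * N t)
      + real T / 2 * (2 * D * \<gamma> + D\<^sup>2 * \<rho>max + 4 * \<gamma>\<^sup>2 / \<rho> 1 + \<alpha> * D\<^sup>2 / (2 * real E)))"
    using c by (rule mult_left_mono)
  moreover have "c * (real T / 2) = 1 / (real T + 1)"
  proof -
    have "real T * 2 + 2 \<noteq> 0" "real T + 1 \<noteq> 0" using T by linarith+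
    then show ?thesis using T by (simp add: c_def frac_eq_eq)
  qed
  ultimately have "c * (\<Sum>t = 1..T. real t * R t)
      \<le> 1 / (real T + 1) * (2 * D * \<gamma> + D\<^sup>2 * \<rho>max + 4 * \<gamma>\<^sup>2 / \<rho> 1 + \<alpha> * D\<^sup>2 / (2 * real E))
        + c * (\<Sum>t = 1..T. real t * N t)"
    by (simp only: distrib_left[of c] mult.assoc[symmetric] add.commute)
  then show ?thesis using main unfolding gap_def N_def c_def by linarith
qed

end

section \<open>Measurability of the iterates\<close>

context admm_setting
begin

lemma W_nonempty: "W p \<noteq> {}"
  using z1 by (auto simp: feasible_blocks_def)

context
  fixes N :: "'w measure" and \<xi> :: "nat \<Rightarrow> nat \<Rightarrow> 'p \<Rightarrow> 'w \<Rightarrow> real^'n" and w :: "nat \<Rightarrow> 'w \<Rightarrow> real^'n"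
    and z :: "nat \<Rightarrow> nat \<Rightarrow> 'w \<Rightarrow> (real^'n)^'p" and zb lam :: "nat \<Rightarrow> 'w \<Rightarrow> (real^'n)^'p"
  assumes algorithm: "\<And>\<omega>. \<omega> \<in> space N \<Longrightarrow> dp_linearized_admm W g \<rho> \<eta> T E lam1 z1
      (\<lambda>t e p. \<xi> t e p \<omega>) (\<lambda>t. w t \<omega>) (\<lambda>t e. z t e \<omega>) (\<lambda>t. zb t \<omega>) (\<lambda>t. lam t \<omega>)"
    and g_measurable: "\<And>p. g p \<in> borel_measurable (restrict_space borel (W p))"
begin

lemma admm_run_at: "\<omega> \<in> space N \<Longrightarrow> admm_run W f g \<rho> \<eta> T E \<alpha> lam1 z1
    (\<lambda>t e p. \<xi> t e p \<omega>) (\<lambda>t. w t \<omega>) (\<lambda>t e. z t e \<omega>) (\<lambda>t. zb t \<omega>) (\<lambda>t. lam t \<omega>)"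
  using algorithm by (intro admm_run.intro admm_run_axioms.intro admm_setting_axioms)

lemma w_measurable:
  assumes t: "t \<in> {1..T}"
    and [measurable]: "\<And>p. (\<lambda>\<omega>. zb t \<omega> $ p) \<in> borel_measurable N" "\<And>p. (\<lambda>\<omega>. lam t \<omega> $ p) \<in> borel_measurable N"
  shows "w (t + 1) \<in> borel_measurable N"
proof -
  have "w (t + 1) \<omega> = (1 / real CARD('p)) *\<^sub>R (\<Sum>p\<in>UNIV. zb t \<omega> $ p - (1 / \<rho> t) *\<^sub>R lam t \<omega> $ p)"
    if "\<omega> \<in> space N" for \<omega>
    by (rule admm_run.w_step[OF admm_run_at[OF that] t])
  then show ?thesis by (subst measurable_cong) measurable
qed

text \<open>The selected subgradient is measurable only on the feasible set, where the iterate stays.\<close>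

lemma subgradient_at_iterate_measurable:
  assumes te: "t \<in> {1..T}" "e \<in> {1..E + 1}" and z: "(\<lambda>\<omega>. z t e \<omega> $ p) \<in> borel_measurable N"
  shows "(\<lambda>\<omega>. g p (z t e \<omega> $ p)) \<in> borel_measurable N"
proof -
  have "(\<lambda>\<omega>. z t e \<omega> $ p) \<in> N \<rightarrow>\<^sub>M restrict_space borel (W p)"
    using admm_run.z_feasible[OF admm_run_at te]
    by (intro measurable_restrict_space2 z) (auto simp: feasible_blocks_def)
  then show ?thesis by (rule measurable_compose[OF _ g_measurable])
qed

lemma local_iterate_measurable:
  assumes t: "t \<in> {1..T}"
    and w: "w (t + 1) \<in> borel_measurable N"
    and lam: "\<And>p. (\<lambda>\<omega>. lam t \<omega> $ p) \<in> borel_measurable N"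
    and first: "\<And>p. (\<lambda>\<omega>. z t 1 \<omega> $ p) \<in> borel_measurable N"
    and "1 \<le> e" "e \<le> E + 1"
    and \<xi>: "\<And>d p. d \<in> {1..E} \<Longrightarrow> d < e \<Longrightarrow> \<xi> t d p \<in> borel_measurable N"
  shows "(\<lambda>\<omega>. z t e \<omega> $ p) \<in> borel_measurable N"
  using assms(5-)
proof (induction e arbitrary: p rule: dec_induct)
  case base
  show ?case by (rule first)
next
  case (step e)
  have e: "e \<in> {1..E}" using step by auto
  have iterate: "(\<lambda>\<omega>. z t e \<omega> $ p) \<in> borel_measurable N" using step by auto
  have gradient: "(\<lambda>\<omega>. g p (z t e \<omega> $ p)) \<in> borel_measurable N"
    using e by (intro subgradient_at_iterate_measurable[OF t _ iterate]) auto
  have noise: "\<xi> t e p \<in> borel_measurable N" using step e by auto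
  have projection: "closest_point (W p) \<in> borel_measurable borel"
    using W_convex W_closed W_nonempty
    by (intro borel_measurable_continuous_onI continuous_on_closest_point)
  have "z t (e + 1) \<omega> $ p = closest_point (W p) (step_centre (\<eta> t) (\<rho> t) (z t e \<omega> $ p)
      (g p (z t e \<omega> $ p)) (w (t + 1) \<omega>) (lam t \<omega> $ p) (\<xi> t e p \<omega>))" if \<omega>: "\<omega> \<in> space N" for \<omega>
    using t eta_pos rho_pos
    by (intro local_step_is_projection[OF admm_run.local_step[OF admm_run_at[OF \<omega>] t e] W_closed W_convex])
      auto
  moreover have "(\<lambda>\<omega>. closest_point (W p) (step_centre (\<eta> t) (\<rho> t) (z t e \<omega> $ p)
      (g p (z t e \<omega> $ p)) (w (t + 1) \<omega>) (lam t \<omega> $ p) (\<xi> t e p \<omega>))) \<in> borel_measurable N"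
    unfolding step_centre_def
    by (intro measurable_compose[OF _ projection] borel_measurable_scaleR borel_measurable_add
        borel_measurable_diff borel_measurable_const iterate gradient noise w lam)
  ultimately have "(\<lambda>\<omega>. z t (e + 1) \<omega> $ p) \<in> borel_measurable N"
    by (subst measurable_cong)
  then show ?case by simp
qed

text \<open>The last local iterate of the previous round belongs to the state because the local loop restarts
  from it and not from the averaged iterate.\<close>

lemma round_state_measurable:
  assumes "1 \<le> t" "t \<le> T + 1"
    and \<xi>: "\<And>s d p. 1 \<le> s \<Longrightarrow> s < t \<Longrightarrow> d \<in> {1..E} \<Longrightarrow> \<xi> s d p \<in> borel_measurable N"
  shows "(\<lambda>\<omega>. zb t \<omega> $ p) \<in> borel_measurable N \<and> (\<lambda>\<omega>. lam t \<omega> $ p) \<in> borel_measurable N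
    \<and> (\<lambda>\<omega>. z (t - 1) (E + 1) \<omega> $ p) \<in> borel_measurable N"
  using assms
proof (induction t arbitrary: p rule: dec_induct)
  case base
  have "zb 1 \<omega> = z1" "lam 1 \<omega> = lam1" "z 0 (E + 1) \<omega> = z1" if "\<omega> \<in> space N" for \<omega>
    using admm_run.start[OF admm_run_at[OF that]] by auto
  then show ?case by (auto cong: measurable_cong)
next
  case (step t)
  have t: "t \<in> {1..T}" using step by auto
  have zb: "(\<lambda>\<omega>. zb t \<omega> $ p) \<in> borel_measurable N"
    and lam: "(\<lambda>\<omega>. lam t \<omega> $ p) \<in> borel_measurable N"
    and last: "(\<lambda>\<omega>. z (t - 1) (E + 1) \<omega> $ p) \<in> borel_measurable N" for p
    using step by auto
  have w: "w (t + 1) \<in> borel_measurable N" by (rule w_measurable[OF t zb lam])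
  have first: "(\<lambda>\<omega>. z t 1 \<omega> $ p) \<in> borel_measurable N" for p
    using last[of p] admm_run.z_first[OF admm_run_at t] by (simp cong: measurable_cong)
  have z: "(\<lambda>\<omega>. z t e \<omega> $ p) \<in> borel_measurable N" if "e \<in> {1..E + 1}" for e p
    using that step by (intro local_iterate_measurable[OF t w lam first]) auto
  have zb': "(\<lambda>\<omega>. zb (t + 1) \<omega> $ p) \<in> borel_measurable N" for p
  proof -
    have "zb (t + 1) \<omega> $ p = (1 / real E) *\<^sub>R (\<Sum>e = 1..E. z t (e + 1) \<omega> $ p)" if "\<omega> \<in> space N" for \<omega>
      using admm_run.zb_step[OF admm_run_at[OF that] t] by (simp add: sum_component)
    moreover have "(\<lambda>\<omega>. (1 / real E) *\<^sub>R (\<Sum>e = 1..E. z t (e + 1) \<omega> $ p)) \<in> borel_measurable N"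
      by (intro borel_measurable_scaleR borel_measurable_const borel_measurable_sum z) auto
    ultimately show ?thesis by (subst measurable_cong)
  qed
  have "lam (t + 1) \<omega> $ p = lam t \<omega> $ p + \<rho> t *\<^sub>R (w (t + 1) \<omega> - zb (t + 1) \<omega> $ p)" if "\<omega> \<in> space N" for \<omega>
    using admm_run.lam_step[OF admm_run_at[OF that] t] by (simp add: stack_def)
  moreover have "(\<lambda>\<omega>. lam t \<omega> $ p + \<rho> t *\<^sub>R (w (t + 1) \<omega> - zb (t + 1) \<omega> $ p)) \<in> borel_measurable N"
    by (intro borel_measurable_scaleR borel_measurable_add borel_measurable_diff borel_measurable_const lam w zb')
  ultimately have "(\<lambda>\<omega>. lam (t + 1) \<omega> $ p) \<in> borel_measurable N"
    by (subst measurable_cong)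
  then show ?case using zb' z[of "E + 1"] by simp
qed

text \<open>The iterates are explicit functions of the earlier draws. Taking for \<open>N\<close> the history of a draw shows
  that the iterate at which the draw is calibrated is known before it; taking the whole probability
  space gives ordinary measurability.\<close>

lemma iterate_measurable:
  assumes te: "t \<in> {1..T}" "e \<in> {1..E + 1}"
    and \<xi>: "\<And>s d p. 1 \<le> s \<Longrightarrow> d \<in> {1..E} \<Longrightarrow> s < t \<or> s = t \<and> d < e \<Longrightarrow> \<xi> s d p \<in> borel_measurable N"
  shows "(\<lambda>\<omega>. z t e \<omega> $ p) \<in> borel_measurable N"
proof -
  have state: "(\<lambda>\<omega>. zb t \<omega> $ p) \<in> borel_measurable N \<and> (\<lambda>\<omega>. lam t \<omega> $ p) \<in> borel_measurable N
      \<and> (\<lambda>\<omega>. z (t - 1) (E + 1) \<omega> $ p) \<in> borel_measurable N" for p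
    using te \<xi> by (intro round_state_measurable) auto
  have first: "(\<lambda>\<omega>. z t 1 \<omega> $ p) \<in> borel_measurable N" for p
    using state[of p] admm_run.z_first[OF admm_run_at te(1)] by (simp cong: measurable_cong)
  show ?thesis
    using te \<xi> state by (intro local_iterate_measurable[OF te(1) w_measurable[OF te(1)] _ first]) auto
qed

end

end

section \<open>The expected ergodic gap\<close>

lemma stacked_distances_bdd_above:
  fixes W :: "'p::finite \<Rightarrow> (real^'n) set"
  assumes "\<And>p. compact (W p)"
  shows "bdd_above (stacked_distances W)"
proof -
  have "\<exists>K. \<forall>p. \<forall>x\<in>W p. norm x \<le> K p"
  proof (intro choice allI)
    show "\<exists>K. \<forall>x\<in>W p. norm x \<le> K" for p
      using compact_imp_bounded[OF assms] by (simp add: bounded_iff)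
  qed
  then obtain K where K: "\<And>p x. x \<in> W p \<Longrightarrow> norm x \<le> K p" by blast
  have norm: "norm x \<le> sum K UNIV" if "x \<in> feasible_blocks W" for x
  proof -
    have "norm x \<le> (\<Sum>p\<in>UNIV. norm (x $ p))" unfolding norm_vec_def by (intro L2_set_le_sum) auto
    also have "\<dots> \<le> sum K UNIV" using that by (intro sum_mono K) (simp add: feasible_blocks_def)
    finally show ?thesis .
  qed
  show ?thesis
  proof (rule bdd_aboveI)
    fix r assume "r \<in> stacked_distances W"
    then obtain u v where "r = norm (u - v)" "u \<in> feasible_blocks W" "v \<in> feasible_blocks W"
      by (auto simp: stacked_distances_def)
    then show "r \<le> sum K UNIV + sum K UNIV"
      using norm[of u] norm[of v] norm_triangle_ineq4[of u v] by linarith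
  qed
qed

lemma sensitivity_nonneg:
  assumes "gradient_gaps m \<D> g u \<noteq> {}" "bdd_above (gradient_gaps m \<D> g u)"
  shows "0 \<le> sensitivity m \<D> g u"
proof -
  obtain x where x: "x \<in> gradient_gaps m \<D> g u" using assms by blast
  then have "0 \<le> x"
    by (auto simp: gradient_gaps_def mechanism_norm_def intro!: sum_nonneg split: mechanism.split)
  also have "x \<le> sensitivity m \<D> g u"
    unfolding sensitivity_def by (rule cSup_upper[OF x assms(2)])
  finally show ?thesis .
qed

theorem theorem5p5:
  fixes M :: "'w measure"
    and W :: "'p::finite \<Rightarrow> (real^'n) set"
    and \<D> :: "'p \<Rightarrow> 'd list set" and D :: "'p \<Rightarrow> 'd list"
    and f :: "'p \<Rightarrow> 'd list \<Rightarrow> real^'n \<Rightarrow> real"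
    and f' :: "'p \<Rightarrow> 'd list \<Rightarrow> real^'n \<Rightarrow> real^'n"
    and m :: mechanism and \<epsilon> :: real
    and T E :: nat
    and \<rho> \<eta> :: "nat \<Rightarrow> real" and \<rho>max \<gamma> H \<alpha> :: real
    and lam1 z1 :: "(real^'n)^'p"
    and \<xi> :: "nat \<Rightarrow> nat \<Rightarrow> 'p \<Rightarrow> 'w \<Rightarrow> real^'n"
    and w :: "nat \<Rightarrow> 'w \<Rightarrow> real^'n"
    and z :: "nat \<Rightarrow> nat \<Rightarrow> 'w \<Rightarrow> (real^'n)^'p"
    and zb lam :: "nat \<Rightarrow> 'w \<Rightarrow> (real^'n)^'p"
    and w_star :: "real^'n" and z_star lam_star :: "(real^'n)^'p"
    and U1 U2 U3 :: real
  assumes prob: "prob_space M"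
    and sizes: "T \<ge> 1" "E \<ge> 1"
    \<comment> \<open>the consensus problem\<close>
    and W: "\<And>p. compact (W p)" "\<And>p. convex (W p)" "(\<Inter>p. W p) \<noteq> {}"
    and data: "\<And>p. D p \<in> \<D> p"
    and f_convex: "\<And>p D'. D' \<in> \<D> p \<Longrightarrow> convex_on (W p) (f p D')"
    and f'_subgradient:
      "\<And>p D' u. D' \<in> \<D> p \<Longrightarrow> u \<in> W p \<Longrightarrow> is_subgradient (W p) (f p D') u (f' p D' u)"
    and f'_measurable: "\<And>p. f' p (D p) \<in> borel_measurable (restrict_space borel (W p))"
    \<comment> \<open>the algorithm and its noise\<close>
    and mech: "valid_mechanism m" and eps: "\<epsilon> > 0"
    and z1: "\<And>p. z1 $ p \<in> W p"
    and algorithm: "\<And>\<omega>. \<omega> \<in> space M \<Longrightarrow>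
      dp_linearized_admm W (\<lambda>p. f' p (D p)) \<rho> \<eta> T E lam1 z1 (\<lambda>t e p. \<xi> t e p \<omega>)
        (\<lambda>t. w t \<omega>) (\<lambda>t e. z t e \<omega>) (\<lambda>t. zb t \<omega>) (\<lambda>t. lam t \<omega>)"
    and noise: "fresh_noise M m \<epsilon> T E (\<lambda>p. sensitivity m (\<D> p) (f' p)) z \<xi>"
    \<comment> \<open>the constants (boundedness makes the suprema meaningful; for \<open>U2\<close> it follows from compactness)\<close>
    and gaps: "\<And>p t e \<omega>. t \<in> {1..T} \<Longrightarrow> e \<in> {1..E} \<Longrightarrow> \<omega> \<in> space M \<Longrightarrow>
      gradient_gaps m (\<D> p) (f' p) (z t e \<omega> $ p) \<noteq> {} \<and>
      bdd_above (gradient_gaps m (\<D> p) (f' p) (z t e \<omega> $ p))"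
    and U1: "bdd_above (gradient_norms W (\<lambda>p. f' p (D p)))"
      "U1 = Sup (gradient_norms W (\<lambda>p. f' p (D p)))"
    and U2: "U2 = Sup (stacked_distances W)"
    and U3: "bdd_above (variance_consts M m T E (\<lambda>p. sensitivity m (\<D> p) (f' p)) z)"
      "U3 = Sup (variance_consts M m T E (\<lambda>p. sensitivity m (\<D> p) (f' p)) z)"
    \<comment> \<open>condition (i)\<close>
    and rho: "0 < \<rho> 1" "\<And>t. 1 \<le> t \<Longrightarrow> t < T \<Longrightarrow> \<rho> t \<le> \<rho> (t + 1)" "\<rho> T \<le> \<rho>max"
      "\<And>t. 2 \<le> t \<Longrightarrow> t \<le> T \<Longrightarrow> \<rho> t \<le> real t / (real t - 1) * \<rho> (t - 1)"
    \<comment> \<open>condition (ii)\<close>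
    and dual: "dual_optimal W (\<lambda>p. f p (D p)) lam_star"
    and gamma: "\<gamma> > 0" "\<gamma> \<ge> 2 * norm lam_star"
      "\<And>t. 1 \<le> t \<Longrightarrow> t \<le> T \<Longrightarrow> AE \<omega> in M. norm (lam t \<omega>) \<le> \<gamma>"
    \<comment> \<open>condition (iii)\<close>
    and lipschitz: "\<And>p. H-lipschitz_on (W p) (f p (D p))"
    \<comment> \<open>strong convexity and step sizes\<close>
    and alpha: "\<alpha> > 0" "\<And>p. strongly_convex_on \<alpha> (W p) (f p (D p))"
    and eta: "\<And>t. 1 \<le> t \<Longrightarrow> t \<le> T \<Longrightarrow> \<eta> t = 2 / (\<alpha> * (real t + 2))"
    and optimal: "consensus_optimal W (\<lambda>p. f p (D p)) w_star z_star"
  shows "let gap = (\<lambda>\<omega>.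
        total_cost (\<lambda>p. f p (D p)) (z_avg T E (\<lambda>t e. z t e \<omega>))
        - total_cost (\<lambda>p. f p (D p)) z_star
        + \<gamma> * norm (stack (w_avg T (\<lambda>t. w t \<omega>)) - z_avg T E (\<lambda>t e. z t e \<omega>)))
    in integrable M gap \<and>
      prob_space.expectation M gap \<le> 1 / (real T + 1) *
        (2 * U2 * \<gamma> + U2\<^sup>2 * \<rho>max + 4 * \<gamma>\<^sup>2 / \<rho> 1 + \<alpha> * U2\<^sup>2 / (2 * real E)
         + 2 * real CARD('p) * (U1\<^sup>2 + real CARD('n) * U3 / \<epsilon>\<^sup>2) / \<alpha>)"
proof -
  interpret prob_space M by (rule prob)
  define F where "F = (\<lambda>p. f p (D p))"
  define g where "g = (\<lambda>p. f' p (D p))"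
  define \<Delta> where "\<Delta> = (\<lambda>p. sensitivity m (\<D> p) (f' p))"
  have u: "z_star \<in> feasible_blocks W" "z_star = stack w_star"
    using optimal by (auto simp: consensus_optimal_def is_arg_min_def)
  interpret admm_setting W F g \<rho> \<eta> T E \<alpha> lam1 z1
    using sizes W data f_convex f'_subgradient rho eta alpha z1
    by unfold_locales (auto simp: F_def g_def feasible_blocks_def)
  have alg: "\<And>\<omega>. \<omega> \<in> space M \<Longrightarrow> dp_linearized_admm W g \<rho> \<eta> T E lam1 z1
      (\<lambda>t e p. \<xi> t e p \<omega>) (\<lambda>t. w t \<omega>) (\<lambda>t e. z t e \<omega>) (\<lambda>t. zb t \<omega>) (\<lambda>t. lam t \<omega>)"
    using algorithm by (simp add: g_def)
  have g_meas: "\<And>p. g p \<in> borel_measurable (restrict_space borel (W p))"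
    using f'_measurable by (simp add: g_def)
  have run: "admm_run W F g \<rho> \<eta> T E \<alpha> lam1 z1
      (\<lambda>t e p. \<xi> t e p \<omega>) (\<lambda>t. w t \<omega>) (\<lambda>t e. z t e \<omega>) (\<lambda>t. zb t \<omega>) (\<lambda>t. lam t \<omega>)" if "\<omega> \<in> space M" for \<omega>
    using alg that by (intro admm_run.intro admm_run_axioms.intro admm_setting_axioms)
  have \<xi>: "\<xi> t e p \<in> borel_measurable M" if "t \<in> {1..T}" "e \<in> {1..E}" for t e p
    using noise that by (auto simp: fresh_noise_def)

  have diam: "norm (x - y) \<le> U2" if "x \<in> feasible_blocks W" "y \<in> feasible_blocks W" for x y
    unfolding U2 using that stacked_distances_bdd_above[OF W(1)]
    by (intro cSup_upper) (auto simp: stacked_distances_def)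
  have g_bound: "norm (g p x) \<le> U1" if "x \<in> W p" for p x
    unfolding U1(2) using that U1(1) by (intro cSup_upper) (auto simp: gradient_norms_def g_def)
  have V: "variance_const m (\<Delta> p (z t e \<omega> $ p)) \<le> U3"
    if "t \<in> {1..T}" "e \<in> {1..E}" "\<omega> \<in> space M" for t e \<omega> p
    unfolding U3(2) using that U3(1) by (intro cSup_upper) (auto simp: variance_consts_def \<Delta>_def)
  have \<Delta>: "0 \<le> \<Delta> p (z t e \<omega> $ p)" if "t \<in> {1..T}" "e \<in> {1..E}" "\<omega> \<in> space M" for t e \<omega> p
    unfolding \<Delta>_def using gaps[OF that] by (intro sensitivity_nonneg) auto
  have in_W: "z t e \<omega> $ p \<in> W p" if "t \<in> {1..T}" "e \<in> {1..E + 1}" "\<omega> \<in> space M" for t e \<omega> p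
    using admm_run.z_feasible[OF run[OF that(3)] that(1,2)] by (simp add: feasible_blocks_def)

  define C where "C = U1\<^sup>2 + real CARD('n) * U3 / \<epsilon>\<^sup>2"
  define cost where "cost t e \<omega> = noise_cost g \<eta> (\<lambda>t e p. \<xi> t e p \<omega>) (\<lambda>t e. z t e \<omega>) z_star t e" for t e \<omega>
  \<comment> \<open>only here do the laws of the noise enter; \<open>0 \<le> C\<close> is recorded because it bounds a second moment\<close>
  have step_noise: "integrable M (cost t e)
      \<and> 0 \<le> C
      \<and> (\<integral>\<omega>. cost t e \<omega> \<partial>M) \<le> \<eta> t / 2 * (real CARD('p) * C)"
    if te: "t \<in> {1..T}" "e \<in> {1..E}" for t e
  proof -
    have e: "e \<in> {1..E + 1}" using te by auto
    have history: "(\<lambda>\<omega>. z t e \<omega> $ p) \<in> borel_measurable (noise_history M E \<xi> t e p)"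
      "(\<lambda>\<omega>. g p (z t e \<omega> $ p)) \<in> borel_measurable (noise_history M E \<xi> t e p)" for p
    proof -
      show z: "(\<lambda>\<omega>. z t e \<omega> $ p) \<in> borel_measurable (noise_history M E \<xi> t e p)"
        using alg g_meas te(1) e
        by (rule_tac iterate_measurable[where \<xi> = \<xi> and w = w and zb = zb and lam = lam])
          (auto simp: other_draws_def intro!: noise_history_measurable)
      show "(\<lambda>\<omega>. g p (z t e \<omega> $ p)) \<in> borel_measurable (noise_history M E \<xi> t e p)"
        using alg g_meas te(1) e z
        by (rule_tac subgradient_at_iterate_measurable[where \<xi> = \<xi> and w = w and zb = zb and lam = lam]) auto
    qed
    have dev: "norm (z t e \<omega> $ p - z_star $ p) \<le> U2" if \<omega>: "\<omega> \<in> space M" for \<omega> p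
      using Finite_Cartesian_Product.norm_nth_le[of "z t e \<omega> - z_star" p]
        diam[OF admm_run.z_feasible[OF run[OF \<omega>] te(1) e] u(1)] by simp
    note moments = fresh_noise_vector_moments[where M = M and \<Delta> = \<Delta> and z = z and \<xi> = \<xi> and t = t and e = e,
        OF prob noise[folded \<Delta>_def] te mech eps]
    have cross: "integrable M (\<lambda>\<omega>. \<xi> t e p \<omega> \<bullet> (z t e \<omega> $ p - z_star $ p))"
      "(\<integral>\<omega>. \<xi> t e p \<omega> \<bullet> (z t e \<omega> $ p - z_star $ p) \<partial>M) = 0" for p
      using \<Delta>[OF te] V[OF te] history dev by (auto intro!: moments(1,2))
    have square: "integrable M (\<lambda>\<omega>. (norm (g p (z t e \<omega> $ p) + \<xi> t e p \<omega>))\<^sup>2)"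
      "(\<integral>\<omega>. (norm (g p (z t e \<omega> $ p) + \<xi> t e p \<omega>))\<^sup>2 \<partial>M) \<le> C" for p
      unfolding C_def using \<Delta>[OF te] V[OF te] history g_bound[OF in_W[OF te(1) e]]
      by (auto intro!: moments(3,4))
    have "0 \<le> (\<integral>\<omega>. (norm (g undefined (z t e \<omega> $ undefined) + \<xi> t e undefined \<omega>))\<^sup>2 \<partial>M)" by simp
    then have C0: "0 \<le> C" using square(2)[of undefined] by linarith
    have "(\<integral>\<omega>. cost t e \<omega> \<partial>M)
        = (\<Sum>p\<in>UNIV. \<eta> t / 2 * (\<integral>\<omega>. (norm (g p (z t e \<omega> $ p) + \<xi> t e p \<omega>))\<^sup>2 \<partial>M))"
      unfolding cost_def noise_cost_def using cross square(1) by simp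
    also have "\<dots> \<le> (\<Sum>p\<in>(UNIV :: 'p set). \<eta> t / 2 * C)"
      using square(2) eta_pos[of t] te by (intro sum_mono mult_left_mono) auto
    also have "\<dots> = \<eta> t / 2 * (real CARD('p) * C)" by simp
    finally show ?thesis
      using cross square(1) C0 unfolding cost_def[abs_def] noise_cost_def by auto
  qed

  define c where "c = 2 / (real T * (real T + 1))"
  define N where "N \<omega> = (\<Sum>t = 1..T. real t * ((\<Sum>e = 1..E.
      cost t e \<omega>) / real E))" for \<omega>
  have N_int: "integrable M N"
    unfolding N_def[abs_def]
    by (intro Bochner_Integration.integrable_sum integrable_mult_right integrable_divide_zero) (use step_noise in blast)+
  have N_mean: "(\<integral>\<omega>. N \<omega> \<partial>M) \<le> real T * (real CARD('p) * C / \<alpha>)"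
  proof -
    have "(\<integral>\<omega>. N \<omega> \<partial>M) = (\<Sum>t = 1..T. real t * ((\<Sum>e = 1..E.
        (\<integral>\<omega>. cost t e \<omega> \<partial>M)) / real E))"
    proof -
      have inner: "integrable M (\<lambda>\<omega>. (\<Sum>e = 1..E. cost t e \<omega>) / real E)"
        "(\<integral>\<omega>. (\<Sum>e = 1..E. cost t e \<omega>) / real E \<partial>M) = (\<Sum>e = 1..E. (\<integral>\<omega>. cost t e \<omega> \<partial>M)) / real E"
        if t: "t \<in> {1..T}" for t
      proof -
        have cost_int: "integrable M (\<lambda>\<omega>. cost t e \<omega>)" if "e \<in> {1..E}" for e using step_noise[OF t that] by blast
        then show "integrable M (\<lambda>\<omega>. (\<Sum>e = 1..E. cost t e \<omega>) / real E)"
          by (intro integrable_divide_zero Bochner_Integration.integrable_sum)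
        show "(\<integral>\<omega>. (\<Sum>e = 1..E. cost t e \<omega>) / real E \<partial>M) = (\<Sum>e = 1..E. (\<integral>\<omega>. cost t e \<omega> \<partial>M)) / real E"
          using Bochner_Integration.integral_sum[of "{1..E}" M "cost t"] cost_int by simp
      qed
      have "(\<integral>\<omega>. N \<omega> \<partial>M) = (\<Sum>t = 1..T. (\<integral>\<omega>. real t * ((\<Sum>e = 1..E. cost t e \<omega>) / real E) \<partial>M))"
        unfolding N_def using inner(1) by (intro Bochner_Integration.integral_sum integrable_mult_right)
      also have "\<dots> = (\<Sum>t = 1..T. real t * ((\<Sum>e = 1..E. (\<integral>\<omega>. cost t e \<omega> \<partial>M)) / real E))"
        by (intro sum.cong refl) (simp only: integral_mult_right_zero inner(2))
      finally show ?thesis .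
    qed
    also have "\<dots> \<le> (\<Sum>t = 1..T. real t * ((\<Sum>e = 1..E. \<eta> t / 2 * (real CARD('p) * C)) / real E))"
      using step_noise by (intro sum_mono mult_left_mono divide_right_mono) auto
    also have "\<dots> = (\<Sum>t = 1..T. real t * (\<eta> t / 2 * (real CARD('p) * C)))" using sizes by simp
    also have "\<dots> \<le> (\<Sum>t = 1..T. real CARD('p) * C / \<alpha>)"
    proof (rule sum_mono)
      fix t assume t: "t \<in> {1..T}"
      \<comment> \<open>the step size cancels the weight of the round: \<open>t / (\<alpha> (t + 2)) \<le> 1 / \<alpha>\<close>\<close>
      have "0 \<le> real CARD('p) * C" using step_noise[of 1 1] sizes by auto
      moreover have "real t * (\<eta> t / 2) \<le> 1 / \<alpha>"
      proof -
        have "real t * (\<eta> t / 2) = real t / (real t + 2) * (1 / \<alpha>)" using t eta[of t] by simp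
        also have "\<dots> \<le> 1 * (1 / \<alpha>)" using alpha(1) by (intro mult_right_mono) auto
        finally show ?thesis by simp
      qed
      ultimately have "real t * (\<eta> t / 2) * (real CARD('p) * C) \<le> 1 / \<alpha> * (real CARD('p) * C)"
        by (intro mult_right_mono)
      then show "real t * (\<eta> t / 2 * (real CARD('p) * C)) \<le> real CARD('p) * C / \<alpha>" by (simp add: mult.assoc)
    qed
    finally show ?thesis by simp
  qed

  define gap where "gap \<omega> = total_cost F (z_avg T E (\<lambda>t e. z t e \<omega>)) - total_cost F z_star
      + \<gamma> * norm (stack (w_avg T (\<lambda>t. w t \<omega>)) - z_avg T E (\<lambda>t e. z t e \<omega>))" for \<omega>
  define K where "K = 2 * U2 * \<gamma> + U2\<^sup>2 * \<rho>max + 4 * \<gamma>\<^sup>2 / \<rho> 1 + \<alpha> * U2\<^sup>2 / (2 * real E)"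
  have lam_bound: "AE \<omega> in M. \<forall>t\<in>{1..T}. norm (lam t \<omega>) \<le> \<gamma>"
    using gamma(3) by (intro AE_finite_allI) auto
  have pathwise: "AE \<omega> in M. gap \<omega> \<le> 1 / (real T + 1) * K + c * N \<omega>"
    using lam_bound AE_space
  proof eventually_elim
    case (elim \<omega>)
    show ?case unfolding gap_def K_def c_def N_def cost_def
      using elim gamma rho by (intro admm_run.ergodic_gap_bound[OF run[OF elim(2)] u diam]) auto
  qed

  have block_bound: "norm (x $ p) \<le> U2 + norm z_star" if "x \<in> feasible_blocks W" for x p
    using Finite_Cartesian_Product.norm_nth_le[of x p] norm_triangle_sub[of x z_star] diam[OF that u(1)] by linarith
  \<comment> \<open>integrability: iterates are bounded, and \<open>w (t + 1)\<close> is controlled by the bound on \<open>lam t\<close>\<close>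
  have z_int: "integrable M (\<lambda>\<omega>. z t e \<omega> $ p)" if te: "t \<in> {1..T}" "e \<in> {1..E + 1}" for t e p
  proof (rule integrable_const_bound)
    show "AE \<omega> in M. norm (z t e \<omega> $ p) \<le> U2 + norm z_star"
      using admm_run.z_feasible[OF run te] by (intro AE_I2 block_bound)
    show "(\<lambda>\<omega>. z t e \<omega> $ p) \<in> borel_measurable M"
      using alg g_meas te \<xi>
      by (rule_tac iterate_measurable[where \<xi> = \<xi> and w = w and zb = zb and lam = lam]) auto
  qed
  have state_meas: "(\<lambda>\<omega>. zb t \<omega> $ p) \<in> borel_measurable M \<and> (\<lambda>\<omega>. lam t \<omega> $ p) \<in> borel_measurable M
      \<and> (\<lambda>\<omega>. z (t - 1) (E + 1) \<omega> $ p) \<in> borel_measurable M" if t: "t \<in> {1..T}" for t p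
    using alg g_meas t \<xi>
    by (rule_tac round_state_measurable[where \<xi> = \<xi> and w = w and zb = zb and lam = lam]) auto
  have w_int: "integrable M (w (t + 1))" if t: "t \<in> {1..T}" for t
  proof -
    have "integrable M (\<lambda>\<omega>. zb t \<omega> $ p)" for p
    proof (rule integrable_const_bound)
      show "AE \<omega> in M. norm (zb t \<omega> $ p) \<le> U2 + norm z_star"
        using t by (intro AE_I2 block_bound admm_run.zb_feasible[OF run]) auto
    qed (use state_meas[OF t] in blast)
    moreover have "integrable M (\<lambda>\<omega>. lam t \<omega> $ p)" for p
    proof (rule integrable_const_bound)
      show "AE \<omega> in M. norm (lam t \<omega> $ p) \<le> \<gamma>"
        using gamma(3)[of t] t by (auto elim!: eventually_mono intro: order_trans[OF Finite_Cartesian_Product.norm_nth_le])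
    qed (use state_meas[OF t] in blast)
    ultimately have "integrable M (\<lambda>\<omega>. (1 / real CARD('p)) *\<^sub>R (\<Sum>p\<in>UNIV. zb t \<omega> $ p - (1 / \<rho> t) *\<^sub>R lam t \<omega> $ p))"
      by simp
    then show ?thesis
      using admm_run.w_step[OF run t] by (simp cong: Bochner_Integration.integrable_cong)
  qed
  have z_avg_int: "integrable M (\<lambda>\<omega>. z_avg T E (\<lambda>t e. z t e \<omega>) $ p)" for p
    unfolding z_avg_def vector_scaleR_component sum_component
    by (intro Bochner_Integration.integrable_scaleR_right Bochner_Integration.integrable_sum z_int) auto
  have w_avg_int: "integrable M (\<lambda>\<omega>. w_avg T (\<lambda>t. w t \<omega>))"
    unfolding w_avg_def by (intro Bochner_Integration.integrable_scaleR_right Bochner_Integration.integrable_sum w_int)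
  have cost_int: "integrable M (\<lambda>\<omega>. F p (z_avg T E (\<lambda>t e. z t e \<omega>) $ p))" for p
  proof -
    have in_W: "z_avg T E (\<lambda>t e. z t e \<omega>) $ p \<in> W p" if "\<omega> \<in> space M" for \<omega>
      using admm_run.z_avg_feasible[OF run[OF that]] by (simp add: feasible_blocks_def)
    have cont: "continuous_on (W p) (F p)"
      using lipschitz by (auto simp: F_def intro: lipschitz_on_continuous_on)
    then obtain K where K: "\<And>x. x \<in> W p \<Longrightarrow> norm (F p x) \<le> K"
      using compact_imp_bounded[OF compact_continuous_image[OF cont W(1)]] by (auto simp: bounded_iff)
    show ?thesis
    proof (rule integrable_const_bound)
      show "AE \<omega> in M. norm (F p (z_avg T E (\<lambda>t e. z t e \<omega>) $ p)) \<le> K" by (intro AE_I2 K in_W)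
      have "(\<lambda>\<omega>. z_avg T E (\<lambda>t e. z t e \<omega>) $ p) \<in> M \<rightarrow>\<^sub>M restrict_space borel (W p)"
        using z_avg_int[of p] in_W by (intro measurable_restrict_space2) auto
      then show "(\<lambda>\<omega>. F p (z_avg T E (\<lambda>t e. z t e \<omega>) $ p)) \<in> borel_measurable M"
        by (rule measurable_compose[OF _ borel_measurable_continuous_on_restrict[OF cont]])
    qed
  qed
  have dist_int: "integrable M (\<lambda>\<omega>. norm (stack (w_avg T (\<lambda>t. w t \<omega>)) - z_avg T E (\<lambda>t e. z t e \<omega>)))"
  proof (rule Bochner_Integration.integrable_bound)
    let ?d = "\<lambda>\<omega> p. w_avg T (\<lambda>t. w t \<omega>) - z_avg T E (\<lambda>t e. z t e \<omega>) $ p"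
    have norm: "norm (stack (w_avg T (\<lambda>t. w t \<omega>)) - z_avg T E (\<lambda>t e. z t e \<omega>)) = L2_set (\<lambda>p. norm (?d \<omega> p)) UNIV" for \<omega>
      by (simp add: norm_vec_def stack_def)
    have d_int: "integrable M (\<lambda>\<omega>. ?d \<omega> p)" for p using z_avg_int w_avg_int by simp
    then show "integrable M (\<lambda>\<omega>. \<Sum>p\<in>UNIV. norm (?d \<omega> p))" by simp
    show "AE \<omega> in M. norm (norm (stack (w_avg T (\<lambda>t. w t \<omega>)) - z_avg T E (\<lambda>t e. z t e \<omega>)))
        \<le> norm (\<Sum>p\<in>UNIV. norm (?d \<omega> p))"
      unfolding norm by (intro AE_I2) (simp add: L2_set_le_sum sum_nonneg)
    have [measurable]: "(\<lambda>\<omega>. ?d \<omega> p) \<in> borel_measurable M" for p using d_int by (rule borel_measurable_integrable)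
    show "(\<lambda>\<omega>. norm (stack (w_avg T (\<lambda>t. w t \<omega>)) - z_avg T E (\<lambda>t e. z t e \<omega>))) \<in> borel_measurable M"
      unfolding norm L2_set_def by measurable
  qed
  have gap_int: "integrable M gap"
    unfolding gap_def[abs_def] total_cost_def using cost_int dist_int by auto
  have "(\<integral>\<omega>. gap \<omega> \<partial>M) \<le> (\<integral>\<omega>. 1 / (real T + 1) * K + c * N \<omega> \<partial>M)"
    using gap_int N_int pathwise by (intro integral_mono_AE) auto
  also have "\<dots> = 1 / (real T + 1) * K + c * (\<integral>\<omega>. N \<omega> \<partial>M)"
    using N_int by (simp add: prob_space)
  also have "\<dots> \<le> 1 / (real T + 1) * K + c * (real T * (real CARD('p) * C / \<alpha>))"
    using N_mean by (intro add_left_mono mult_left_mono) (auto simp: c_def)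
  also have "c * (real T * (real CARD('p) * C / \<alpha>)) = 1 / (real T + 1) * (2 * real CARD('p) * C / \<alpha>)"
    using sizes by (simp add: c_def)
  finally have "(\<integral>\<omega>. gap \<omega> \<partial>M) \<le> 1 / (real T + 1) * (K + 2 * real CARD('p) * C / \<alpha>)"
    by (simp add: distrib_left)
  then show ?thesis
    using gap_int unfolding gap_def[abs_def] K_def C_def F_def Let_def by blast
qed

end
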